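(* Given any $0$-simplex $\{L\}$ in $\mathcal{G}_A$ (i.e. any virtual knot $L$), for each positive integer $n$ there exists an $n$-simplex of $\mathcal{G}_A$ containing $L$.
   Context: A virtual knot diagram is a generic closed curve in the plane (one component) each of whose double points is marked either as a classical crossing (with over/under information) or as a virtual crossing (drawn encircled). A virtual knot is an equivalence class of virtual knot diagrams modulo the generalized Reidemeister moves (classical RI, RII, RIII, virtual VRI, VRII, VRIII, and the mixed move with one classical and two virtual crossings). An arc $(a,b)$ in a virtual knot diagram $D$ is a segment of the diagram, with end points $a,b$, passing through exactly one pair of (consecutive) crossings, each of which may be classical or virtual. An arc shift move on the arc $(a,b)$ consists of cutting the diagram at two points, one near each of the two crossings (so that the cut-out segment contains the passages through both crossings), and joining the free ends again after switching sides. That is, the cut-out segment is left in place with the two crossings unchanged as over/under/virtual crossings, but the loose end of the rest of the diagram near $a$ is joined to the end of the segment near $b$ and vice versa, so that the segment is traversed in the opposite direction; all new crossings created by the connecting strands are virtual. In terms of signed Gauss diagrams, the order of the passages through the two crossings along the segment is reversed and the signs of those among the two crossings that are classical are changed, over/under being preserved. Any virtual knot can be transformed into any other by arc shift moves together with generalized Reidemeister moves. For two virtual knots $K_1,K_2$, $d_A(K_1,K_2)$ denotes the minimum number of arc shift moves needed to convert a diagram of $K_1$ into a diagram of $K_2$ (generalized Reidemeister moves being allowed freely). The Gordian complex $\mathcal{G}_A$ of virtual knots by arc shift move is the simplicial complex whose vertices are all virtual knots and in which a set of $n+1$ vertices $\{K_0,\dots,K_n\}$ spans an $n$-simplex if and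 only if $d_A(K_i,K_j)=1$ for all $0\le i,j\le n$, $i\ne j$. *)

theory Defs
  imports Main "HOL-Library.Extended_Nat"
begin

text \<open>
  A generic closed curve in the plane, put in general position with respect to the height function,
  is cut by horizontal lines into slices that contain exactly one minimum, maximum or double point.
  Reading the slices from bottom to top gives a word in the elementary pieces below; the second
  component of a letter is the number of strands that pass to the left of the piece.  Planar
  isotopy becomes the moves of the relation \<open>planar_isotopy\<close>.  The curves are not oriented.

  In \<open>Cross k\<close> the tag \<open>k\<close> describes the strand that runs from bottom left to top right:
  it passes over, it passes under, or the crossing is virtual.
\<close>

datatype kind = Over | Under | Virtual

datatype piece = Cup | Cap | Cross kind

type_synonym word = "(piece \<times> nat) list"

fun opp :: "kind \<Rightarrow> kind" where
  "opp Over = Under"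
| "opp Under = Over"
| "opp Virtual = Virtual"

fun ins :: "piece \<Rightarrow> nat" where
  "ins Cup = 0"
| "ins Cap = 2"
| "ins (Cross k) = 2"

fun outs :: "piece \<Rightarrow> nat" where
  "outs Cup = 2"
| "outs Cap = 0"
| "outs (Cross k) = 2"

text \<open>\<open>tangle m w n\<close>: the word \<open>w\<close> can be drawn on top of \<open>m\<close> strands and then ends with \<open>n\<close> strands.\<close>

fun tangle :: "nat \<Rightarrow> word \<Rightarrow> nat \<Rightarrow> bool" where
  "tangle m [] n \<longleftrightarrow> m = n"
| "tangle m ((p, i) # w) n \<longleftrightarrow> i + ins p \<le> m \<and> tangle (m - ins p + outs p) w n"

text \<open>
  The point \<open>(t, x)\<close> is the intersection of the diagram with the horizontal line above the first
  \<open>t\<close> letters that has \<open>x\<close> others to its left.  Two such points are \<open>joined\<close> if they are the ends of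
  a piece of the curve inside one slice; curves run straight through crossings.
\<close>

definition points :: "word \<Rightarrow> (nat \<times> nat) set" where
  "points w = {(t, x). t \<le> length w \<and> (\<exists>n. tangle 0 (take t w) n \<and> x < n)}"

inductive joined :: "word \<Rightarrow> nat \<times> nat \<Rightarrow> nat \<times> nat \<Rightarrow> bool" for w where
  left: "t < length w \<Longrightarrow> w ! t = (p, i) \<Longrightarrow> x < i \<Longrightarrow> joined w (t, x) (Suc t, x)"
| right: "t < length w \<Longrightarrow> w ! t = (p, i) \<Longrightarrow> joined w (t, i + ins p + x) (Suc t, i + outs p + x)"
| cup: "t < length w \<Longrightarrow> w ! t = (Cup, i) \<Longrightarrow> joined w (Suc t, i) (Suc t, i + 1)"
| cap: "t < length w \<Longrightarrow> w ! t = (Cap, i) \<Longrightarrow> joined w (t, i) (t, i + 1)"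
| rising: "t < length w \<Longrightarrow> w ! t = (Cross k, i) \<Longrightarrow> joined w (t, i) (Suc t, i + 1)"
| falling: "t < length w \<Longrightarrow> w ! t = (Cross k, i) \<Longrightarrow> joined w (t, i + 1) (Suc t, i)"

definition one_component :: "word \<Rightarrow> bool" where
  "one_component w \<longleftrightarrow>
     points w \<noteq> {} \<and> (\<forall>a \<in> points w. \<forall>b \<in> points w. equivclp (joined w) a b)"

definition is_diagram :: "word \<Rightarrow> bool" where
  "is_diagram w \<longleftrightarrow> tangle 0 w 0 \<and> one_component w"

lemma is_diagram_circle: "is_diagram [(Cup, 0), (Cap, 0)]"
proof -
  let ?w = "[(Cup, 0), (Cap, 0)]"
  have "points ?w = {(1, 0), (1, 1)}"
  proof (intro set_eqI iffI)
    fix a assume "a \<in> points ?w"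
    then obtain t x n where "a = (t, x)" "t \<le> 2" "tangle 0 (take t ?w) n" "x < n"
      by (auto simp: points_def)
    moreover from \<open>t \<le> 2\<close> have "t = 0 \<or> t = 1 \<or> t = 2" by auto
    ultimately show "a \<in> {(1, 0), (1, 1)}" by auto
  qed (auto simp: points_def)
  moreover have "joined ?w (1, 0) (1, 1)"
    using joined.cup[of 0 ?w 0] by simp
  then have "equivclp (joined ?w) (1, 0) (1, 1)" "equivclp (joined ?w) (1, 1) (1, 0)"
    by (auto intro: r_into_equivclp equivclp_sym)
  ultimately have "one_component ?w"
    by (auto simp: one_component_def)
  then show ?thesis by (simp add: is_diagram_def)
qed

typedef diagram = "{w. is_diagram w}"
  using is_diagram_circle by blast

text \<open>
  Below, the local moves relate two words; in a diagram they are applied to any factor of its word.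

  \<open>far\<close>: a piece \<open>p\<close> and a piece \<open>q\<close> to the right of it may be drawn in either order.
  \<open>slide\<close>: a strand crossing a minimum (maximum) passes over from one leg to the other.  The
  transversal strand keeps its role, so the tag, which refers to the rising strand, is reversed.
\<close>

inductive planar_isotopy :: "word \<Rightarrow> word \<Rightarrow> bool" where
  far: "i \<le> j \<Longrightarrow> planar_isotopy [(p, i), (q, j + outs p)] [(q, j + ins p), (p, i)]"
| zigzag_left: "planar_isotopy [(Cup, i), (Cap, i + 1)] []"
| zigzag_right: "planar_isotopy [(Cup, i + 1), (Cap, i)] []"
| slide_cup: "planar_isotopy [(Cup, i), (Cross k, i + 1)] [(Cup, i + 1), (Cross (opp k), i)]"
| slide_cap: "planar_isotopy [(Cross k, i + 1), (Cap, i)] [(Cross (opp k), i), (Cap, i + 1)]"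

text \<open>
  The tags of the crossings between the strands numbered 1 2, 1 3, 2 3 from the left at the bottom.
  Three classical crossings admit the third move unless the three strands lie cyclically over one
  another; otherwise at least two crossings must be virtual (the purely virtual move and the mixed
  move).  The move with exactly two classical crossings is forbidden.
\<close>

definition R3_admissible :: "kind \<Rightarrow> kind \<Rightarrow> kind \<Rightarrow> bool" where
  "R3_admissible k12 k13 k23 \<longleftrightarrow>
     (Virtual \<notin> {k12, k13, k23} \<and> \<not> (k12 = k23 \<and> k13 \<noteq> k12)) \<or>
     (k12 = Virtual \<and> k13 = Virtual) \<or> (k12 = Virtual \<and> k23 = Virtual) \<or>
     (k13 = Virtual \<and> k23 = Virtual)"

text \<open>With \<open>k = Virtual\<close> the rules \<open>R1_cup\<close>, \<open>R1_cap\<close> and \<open>R2\<close> are the virtual first and second moves.\<close>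

inductive reidemeister :: "word \<Rightarrow> word \<Rightarrow> bool" where
  R1_cup: "reidemeister [(Cup, i), (Cross k, i)] [(Cup, i)]"
| R1_cap: "reidemeister [(Cross k, i), (Cap, i)] [(Cap, i)]"
| R2: "reidemeister [(Cross k, i), (Cross (opp k), i)] []"
| R3: "R3_admissible k12 k13 k23 \<Longrightarrow>
    reidemeister [(Cross k12, i), (Cross k13, i + 1), (Cross k23, i)]
                 [(Cross k23, i + 1), (Cross k13, i), (Cross k12, i + 1)]"

text \<open>
  In \<open>rightward\<close> the arc is the strand that enters at position \<open>i\<close> and crosses two upward strands,
  first with tag \<open>k\<close>, then with tag \<open>l\<close>.  After the move it first runs to the far end of the segment
  (two virtual crossings), then traverses the segment from right to left, and finally returns to the
  right (two virtual crossings).  The arc keeps its role at both crossings, but it is no longer the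
  rising strand there; hence the reversed tags.  \<open>leftward\<close> is the mirror image.  The two strands
  that are crossed may be assumed to run upwards by planar isotopy.
\<close>

inductive arc_shift :: "word \<Rightarrow> word \<Rightarrow> bool" where
  rightward: "arc_shift
    [(Cross k, i), (Cross l, i + 1)]
    [(Cross Virtual, i), (Cross Virtual, i + 1),
     (Cross (opp l), i + 1), (Cross (opp k), i),
     (Cross Virtual, i), (Cross Virtual, i + 1)]"
| leftward: "arc_shift
    [(Cross k, i + 1), (Cross l, i)]
    [(Cross Virtual, i + 1), (Cross Virtual, i),
     (Cross (opp l), i), (Cross (opp k), i + 1),
     (Cross Virtual, i + 1), (Cross Virtual, i)]"

definition locally :: "(word \<Rightarrow> word \<Rightarrow> bool) \<Rightarrow> diagram \<Rightarrow> diagram \<Rightarrow> bool" where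
  "locally R D D' \<longleftrightarrow>
     (\<exists>u v w w'. R w w' \<and> Rep_diagram D = u @ w @ v \<and> Rep_diagram D' = u @ w' @ v)"

definition generalized_move :: "diagram \<Rightarrow> diagram \<Rightarrow> bool" where
  "generalized_move D D' \<longleftrightarrow> locally planar_isotopy D D' \<or> locally reidemeister D D'"

quotient_type virtual_knot = diagram / "equivclp generalized_move"
  by (rule equivp_evquivclp)

definition shift_step :: "virtual_knot \<Rightarrow> virtual_knot \<Rightarrow> bool" where
  "shift_step K K' \<longleftrightarrow>
     (\<exists>D D'. abs_virtual_knot D = K \<and> abs_virtual_knot D' = K' \<and> locally arc_shift D D')"

text \<open>The distance is \<open>\<infinity>\<close> if no number of arc shift moves suffices.\<close>

definition d_A :: "virtual_knot \<Rightarrow> virtual_knot \<Rightarrow> enat" where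
  "d_A K K' = Inf (enat ` {n. (shift_step ^^ n) K K'})"

definition gordian_complex :: "virtual_knot set set" where
  "gordian_complex =
     {S. finite S \<and> S \<noteq> {} \<and> (\<forall>K \<in> S. \<forall>K' \<in> S. K \<noteq> K' \<longrightarrow> d_A K K' = 1)}"

definition is_simplex :: "nat \<Rightarrow> virtual_knot set \<Rightarrow> bool" where
  "is_simplex n S \<longleftrightarrow> S \<in> gordian_complex \<and> card S = n + 1"

end

theory Submission
  imports Defs
begin

text \<open>
  The vertices of the simplex are obtained from a diagram of \<open>L\<close> by inserting long knots
  \<open>long_chain 0\<close>, \<open>long_chain 1\<close>, \<dots> into one strand.  The long knot with number \<open>n\<close> consists of
  \<open>n\<close> nested \<^emph>\<open>gates\<close> around a single chord; without gates it is isotopic to a straight strand, so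
  \<open>L\<close> itself is the vertex with number \<open>0\<close>.

  \<^bold>\<open>Adjacency.\<close>  Changing the sign of one classical crossing while keeping its over strand is a single
  arc shift, because a pair of virtual crossings can be created next to it (\<open>shift_step_flip\<close>), and
  this change can be undone in the same way.  A gate runs a strand twice through a tangle \<open>B\<close>: up
  along the third strand of \<open>B\<close>, back down outside \<open>B\<close>, and from a minimum up along the fourth strand.
  Above \<open>B\<close> the two legs of this minimum are clasped together, and the clasp is conjugated by a sweep
  of a further strand below both legs.  This makes the gate behave like a commutator of \<open>B\<close> with the clasp.

  \<^item> Without the clasp the two sweeps cancel, and the gate falls apart: \<open>B\<close> remains, its two strands
    are joined to one, and the sweeping strand is straight (\<open>flip_gate\<close>).
  \<^item> If the fourth strand of \<open>B\<close> is straight, then the sweeping strand slides off the minimum, the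
    clasp untwists by first Reidemeister moves, and again only \<open>B\<close> remains (\<open>isotopic_gate_passive\<close>).

  The clasp is chosen such that one sign change makes it trivial.  If this is done in gate number
  \<open>j + 1\<close>, then that gate has a straight last strand, hence the gates around it dissolve one after
  the other, and what remains is \<open>long_chain j\<close>.  So one arc shift leads from \<open>long_chain n\<close> to
  \<open>long_chain j\<close> for \<^emph>\<open>every\<close> \<open>j < n\<close> (\<open>flip_long_chain\<close>).

  \<^bold>\<open>Distinctness.\<close>  The number of colourings by a symmetric quandle is an invariant.  The colours used
  here are integers modulo an odd number \<open>N\<close>, and passing under a strand of colour \<open>y\<close> replaces \<open>b\<close> by
  \<open>(b + y) / 2\<close> or by \<open>2 b - y\<close>, according to the direction of the upper strand.  A long knot of the
  family is transparent for colours: it ends with the colour \<open>u\<close> with which it begins.  In one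
  orientation its inner colours are determined by one unknown \<open>w\<close> with
  \<open>(9 * 3^n - 7 * 2^n) * (w - u) = 0\<close>, in the other orientation they are determined by \<open>u\<close>.  Modulo
  \<open>N = 9 * 3^n - 7 * 2^n\<close> the first number of colourings is \<open>N\<close> for \<open>long_chain n\<close> and smaller than \<open>N\<close>
  for \<open>long_chain j\<close> with \<open>j < n\<close>.  Since \<open>L\<close> has colourings in which all numbers are zero, one for each
  orientation of the curve, the numbers of colourings after insertion differ, whatever \<open>L\<close> is.

  Colourings serve a second purpose.  A move may only be used between words of diagrams, that is, of
  curves with one component; this condition says that there are exactly two colourings
  by the trivial quandle with two elements, so its invariance is a special case of the invariance of colourings.
\<close>

section \<open>Words as tangles\<close>

lemma tangle_append: "tangle m (u @ v) n \<longleftrightarrow> (\<exists>k. tangle m u k \<and> tangle k v n)"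
proof (induction u arbitrary: m)
  case (Cons a u)
  obtain p i where "a = (p, i)" by fastforce
  then show ?case using Cons[of "m - ins p + outs p"] by simp
qed simp

lemma tangle_appendI: "tangle m u k \<Longrightarrow> tangle k v n \<Longrightarrow> tangle m (u @ v) n"
  by (auto simp: tangle_append)

lemma tangle_unique: "tangle m w n \<Longrightarrow> tangle m w n' \<Longrightarrow> n = n'"
  by (induction w arbitrary: m) auto

lemma tangle_add_strands: "tangle m w n \<Longrightarrow> tangle (m + k) w (n + k)"
proof (induction w arbitrary: m)
  case (Cons a w)
  obtain p i where a: "a = (p, i)" by fastforce
  have 1: "i + ins p \<le> m" and 2: "tangle (m - ins p + outs p + k) w (n + k)"
    using Cons.prems Cons.IH unfolding a tangle.simps by blast+
  have "m - ins p + outs p + k = m + k - ins p + outs p" using 1 by auto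
  with 1 2 a show ?case by simp
qed simp

section \<open>Colourings by a symmetric quandle\<close>

text \<open>
  Strands are not oriented, so a colour always refers to the strand read upwards, and \<open>bar\<close> gives the
  colour of the same strand read in the opposite direction.  \<open>act x b\<close> is the colour that \<open>b\<close> gets when
  it passes below a strand of colour \<open>x\<close> from its right to its left side; reading that strand in the
  opposite direction exchanges the sides, hence \<open>act (bar x)\<close> is inverse to \<open>act x\<close>.
\<close>

locale symmetric_quandle =
  fixes C :: "'c set" and bar :: "'c \<Rightarrow> 'c" and act :: "'c \<Rightarrow> 'c \<Rightarrow> 'c"
  assumes finite_C: "finite C"
    and bar_closed [simp]: "x \<in> C \<Longrightarrow> bar x \<in> C"
    and act_closed [simp]: "x \<in> C \<Longrightarrow> b \<in> C \<Longrightarrow> act x b \<in> C"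
    and bar_bar [simp]: "x \<in> C \<Longrightarrow> bar (bar x) = x"
    and act_bar_act [simp]: "x \<in> C \<Longrightarrow> b \<in> C \<Longrightarrow> act (bar x) (act x b) = b"
    and act_same [simp]: "x \<in> C \<Longrightarrow> act x x = x"
    and bar_act: "x \<in> C \<Longrightarrow> b \<in> C \<Longrightarrow> bar (act x b) = act x (bar b)"
    and act_act: "x \<in> C \<Longrightarrow> y \<in> C \<Longrightarrow> b \<in> C \<Longrightarrow> act x (act y b) = act (act x y) (act x b)"
begin

lemma act_act_bar [simp]: "x \<in> C \<Longrightarrow> b \<in> C \<Longrightarrow> act x (act (bar x) b) = b"
  using act_bar_act[of "bar x" b] by simp

fun cross :: "kind \<Rightarrow> 'c \<Rightarrow> 'c \<Rightarrow> 'c list" where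
  "cross Over x y = [act x y, x]"
| "cross Under x y = [y, act (bar y) x]"
| "cross Virtual x y = [y, x]"

text \<open>
  A state lists the colours of the strands at some height.  A step goes to the possible states above
  one piece; only a minimum offers a choice, and only a maximum imposes a condition.  The recursion
  over the position in \<open>step\<close> reduces every local computation to the left end of the state.
\<close>

fun left_step :: "piece \<Rightarrow> 'c list \<Rightarrow> 'c list set" where
  "left_step Cup s = (\<lambda>x. x # bar x # s) ` C"
| "left_step Cap (x # y # s) = (if y = bar x then {s} else {})"
| "left_step (Cross k) (x # y # s) = {cross k x y @ s}"
| "left_step p s = {}"

fun step :: "piece \<Rightarrow> nat \<Rightarrow> 'c list \<Rightarrow> 'c list set" where
  "step p 0 s = left_step p s"
| "step p (Suc i) (x # s) = (#) x ` step p i s"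
| "step p (Suc i) [] = {}"

text \<open>
  The sum of the values of \<open>\<phi>\<close> at the top, over all colourings that start with the state \<open>s\<close> at the
  bottom.  Keeping \<open>\<phi>\<close> arbitrary turns composition of tangles into composition of functions, so that
  a local move can be verified without its surroundings.
\<close>

fun ev :: "word \<Rightarrow> ('c list \<Rightarrow> nat) \<Rightarrow> 'c list \<Rightarrow> nat" where
  "ev [] \<phi> s = \<phi> s"
| "ev ((p, i) # w) \<phi> s = (\<Sum>s' \<in> step p i s. ev w \<phi> s')"

lemma ev_append: "ev (u @ v) \<phi> s = ev u (ev v \<phi>) s"
  by (induction u arbitrary: s) auto

lemma length_cross [simp]: "length (cross k x y) = 2"
  by (cases k) auto

lemma left_step_length:
  "s' \<in> left_step p s \<Longrightarrow> ins p \<le> length s \<and> length s' = length s - ins p + outs p"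
  by (induction p s rule: left_step.induct) (auto split: if_splits)

lemma left_step_closed: "set s \<subseteq> C \<Longrightarrow> s' \<in> left_step p s \<Longrightarrow> set s' \<subseteq> C"
proof (induction p s rule: left_step.induct)
  case (3 k x y s)
  then show ?case by (cases k) auto
qed (auto split: if_splits)

lemma step_length:
  "s' \<in> step p i s \<Longrightarrow> i + ins p \<le> length s \<and> length s' = length s - ins p + outs p"
proof (induction p i s arbitrary: s' rule: step.induct)
  case (1 p s) then show ?case using left_step_length by simp
next
  case (2 p i x s)
  then show ?case by (fastforce)
qed auto

lemma step_closed: "set s \<subseteq> C \<Longrightarrow> s' \<in> step p i s \<Longrightarrow> set s' \<subseteq> C"
  by (induction p i s arbitrary: s' rule: step.induct) (auto dest: left_step_closed, blast+)

lemma step_prefix: "step p (length l + j) (l @ s) = (@) l ` step p j s"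
  by (induction l) (auto simp: image_iff)

lemma ev_cong:
  assumes "tangle m w n" "length s = m" "set s \<subseteq> C"
    and "\<And>s'. length s' = n \<Longrightarrow> set s' \<subseteq> C \<Longrightarrow> \<phi> s' = \<psi> s'"
  shows "ev w \<phi> s = ev w \<psi> s"
  using assms(1-3)
proof (induction w arbitrary: m s)
  case Nil then show ?case using assms(4) by simp
next
  case (Cons a w)
  obtain p i where a: "a = (p, i)" by fastforce
  show ?case
    unfolding a ev.simps
  proof (rule sum.cong[OF refl])
    fix s' assume s': "s' \<in> step p i s"
    show "ev w \<phi> s' = ev w \<psi> s'"
      using Cons.IH[of "m - ins p + outs p" s'] Cons.prems a step_length[OF s'] step_closed[OF _ s']
      by auto
  qed
qed

text \<open>
  The moves are given for every position \<open>i\<close>; by \<open>ev_shift\<close> it suffices to consider \<open>i = 0\<close>.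
\<close>

definition shift :: "nat \<Rightarrow> word \<Rightarrow> word" where
  "shift i w = map (\<lambda>(p, j). (p, i + j)) w"

lemma ev_shift: "ev (shift (length l) w) \<phi> (l @ s) = ev w (\<lambda>s'. \<phi> (l @ s')) s"
proof (induction w arbitrary: s)
  case (Cons a w)
  obtain p j where a: "a = (p, j)" by fastforce
  have "inj_on ((@) l) (step p j s)" by (auto simp: inj_on_def)
  with Cons show ?case
    by (simp add: a shift_def step_prefix sum.reindex)
qed (simp add: shift_def)

lemma sum_step_Suc [simp]: "(\<Sum>s' \<in> step p (Suc i) (x # s). f s') = (\<Sum>s' \<in> step p i s. f (x # s'))"
  by (simp add: sum.reindex)

lemma sum_step_Cup [simp]: "(\<Sum>s' \<in> step Cup 0 s. f s') = (\<Sum>x \<in> C. f (x # bar x # s))"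
  by (simp add: sum.reindex inj_on_def)

lemma sum_step_Cap [simp]:
  "(\<Sum>s' \<in> step Cap 0 (x # y # s). f s') = (if y = bar x then f s else 0)"
  by simp

lemma sum_step_Cross [simp]: "(\<Sum>s' \<in> step (Cross k) 0 (x # y # s). f s') = f (cross k x y @ s)"
  by simp

declare step.simps [simp del]

lemma left_step_split:
  assumes "length h = ins p"
  shows "left_step p (h @ t) = (\<lambda>h'. h' @ t) ` left_step p h"
proof (cases p)
  case Cup
  with assms show ?thesis by (auto simp: image_iff)
next
  case Cap
  with assms obtain x y where "h = [x, y]" by (auto simp: length_Suc_conv numeral_2_eq_2)
  with Cap show ?thesis by auto
next
  case (Cross k)
  with assms obtain x y where "h = [x, y]" by (auto simp: length_Suc_conv numeral_2_eq_2)
  with Cross show ?thesis by auto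
qed

text \<open>
  The two pieces act on disjoint parts of the state, so both sides are the same double sum in
  different order.
\<close>

lemma ev_far_left:
  assumes "length h = ins p"
  shows "ev [(p, 0), (q, outs p + j)] \<phi> (h @ t) = ev [(q, ins p + j), (p, 0)] \<phi> (h @ t)"
proof -
  have outs: "length h' = outs p" if "h' \<in> left_step p h" for h'
    using left_step_length[OF that] assms by simp
  have "ev [(p, 0), (q, outs p + j)] \<phi> (h @ t)
      = (\<Sum>h' \<in> left_step p h. \<Sum>s' \<in> step q (outs p + j) (h' @ t). \<phi> s')"
    by (simp add: step.simps left_step_split[OF assms] sum.reindex inj_on_def)
  also have "\<dots> = (\<Sum>h' \<in> left_step p h. \<Sum>t' \<in> step q j t. \<phi> (h' @ t'))"
  proof (rule sum.cong[OF refl])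
    fix h' assume "h' \<in> left_step p h"
    then have "outs p = length h'" using outs by simp
    then show "(\<Sum>s' \<in> step q (outs p + j) (h' @ t). \<phi> s') = (\<Sum>t' \<in> step q j t. \<phi> (h' @ t'))"
      by (simp add: step_prefix sum.reindex inj_on_def)
  qed
  also have "\<dots> = (\<Sum>t' \<in> step q j t. \<Sum>h' \<in> left_step p h. \<phi> (h' @ t'))"
    by (rule sum.swap)
  also have "\<dots> = ev [(q, ins p + j), (p, 0)] \<phi> (h @ t)"
    by (simp add: assms[symmetric] step_prefix sum.reindex inj_on_def step.simps left_step_split[OF assms])
  finally show ?thesis .
qed

lemma sum_C_bar: "(\<Sum>x \<in> C. f (bar x)) = (\<Sum>x \<in> C. f x)"
  by (rule sum.reindex_bij_witness[where i = bar and j = bar]) auto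

lemma sum_C_act: "a \<in> C \<Longrightarrow> (\<Sum>x \<in> C. f (act a x)) = (\<Sum>x \<in> C. f x)"
  by (rule sum.reindex_bij_witness[where i = "act (bar a)" and j = "act a"]) auto

lemma sum_C_delta: "a \<in> C \<Longrightarrow> (\<Sum>x \<in> C. if x = a then f x else 0) = (f a :: nat)"
  using finite_C by simp

lemma ev_zigzag_left: "x \<in> C \<Longrightarrow> ev [(Cup, 0), (Cap, 1)] \<phi> (x # s) = \<phi> (x # s)"
proof -
  assume x: "x \<in> C"
  have "ev [(Cup, 0), (Cap, 1)] \<phi> (x # s) = (\<Sum>y \<in> C. if y = x then \<phi> (y # s) else 0)"
    by (auto intro!: sum.cong)
  then show ?thesis using sum_C_delta[OF x] by simp
qed

lemma ev_zigzag_right: "x \<in> C \<Longrightarrow> ev [(Cup, 1), (Cap, 0)] \<phi> (x # s) = \<phi> (x # s)"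
proof -
  assume x: "x \<in> C"
  have "ev [(Cup, 1), (Cap, 0)] \<phi> (x # s) = (\<Sum>y \<in> C. if y = bar x then \<phi> (bar y # s) else 0)"
    by (auto intro!: sum.cong)
  then show ?thesis using x by (simp add: sum_C_delta)
qed

text \<open>
  If the leg of the minimum passes below \<open>x\<close>, the choice of the colour at the minimum differs by
  \<open>act x\<close> between the two sides; this is a permutation of the colours.
\<close>

lemma ev_slide_cup:
  assumes "x \<in> C"
  shows "ev [(Cup, 0), (Cross k, 1)] \<phi> (x # s) = ev [(Cup, 1), (Cross (opp k), 0)] \<phi> (x # s)"
proof (cases k)
  case Under
  have "ev [(Cup, 0), (Cross k, 1)] \<phi> (x # s)
      = (\<Sum>y \<in> C. \<phi> (act x (act (bar x) y) # x # bar (act (bar x) y) # s))"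
    using assms Under by (auto intro!: sum.cong simp: bar_act)
  also have "\<dots> = (\<Sum>y \<in> C. \<phi> (act x y # x # bar y # s))"
    using assms sum_C_act[of "bar x" "\<lambda>y. \<phi> (act x y # x # bar y # s)"] by simp
  finally show ?thesis using assms Under by simp
qed (use assms in auto)

lemma ev_slide_cap:
  assumes "x \<in> C" "y \<in> C" "z \<in> C"
  shows "ev [(Cross k, 1), (Cap, 0)] \<phi> (x # y # z # s) = ev [(Cross (opp k), 0), (Cap, 1)] \<phi> (x # y # z # s)"
proof -
  have "bar (act (bar y) x) = act (bar y) (bar x)"
    using assms by (simp add: bar_act)
  then have "z = bar (act (bar y) x) \<longleftrightarrow> act y z = bar x"
    using assms by (metis act_act_bar act_bar_act bar_closed)
  then show ?thesis
    using assms by (cases k) auto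
qed

lemma ev_R1_cup: "ev [(Cup, 0), (Cross k, 0)] \<phi> s = ev [(Cup, 0)] \<phi> s"
proof -
  have *: "(\<Sum>x \<in> C. \<phi> (bar x # x # s)) = (\<Sum>x \<in> C. \<phi> (x # bar x # s))"
    using sum_C_bar[of "\<lambda>x. \<phi> (x # bar x # s)"] by simp
  have "act x (bar x) = bar x" if "x \<in> C" for x
    using bar_act[of x x] that by simp
  then show ?thesis using * by (cases k) auto
qed

lemma ev_R1_cap:
  assumes "x \<in> C" "y \<in> C"
  shows "ev [(Cross k, 0), (Cap, 0)] \<phi> (x # y # s) = ev [(Cap, 0)] \<phi> (x # y # s)"
proof -
  have over: "x = bar (act x y) \<longleftrightarrow> y = bar x"
  proof
    assume "x = bar (act x y)"
    then have "act x y = bar x" using assms by (metis act_closed bar_bar)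
    then have "act (bar x) (act x y) = act (bar x) (bar x)" by (rule arg_cong)
    then show "y = bar x" using assms by simp
  next
    assume "y = bar x"
    then show "x = bar (act x y)" using assms by (simp add: bar_act)
  qed
  have under: "act (bar y) x = bar y \<longleftrightarrow> y = bar x"
  proof
    assume "act (bar y) x = bar y"
    then have "act y (act (bar y) x) = act y (bar y)" by (rule arg_cong)
    then have "x = bar y" using assms by (simp flip: bar_act)
    then show "y = bar x" using assms(2) by simp
  qed (use assms in simp)
  have virtual: "x = bar y \<longleftrightarrow> y = bar x" using assms by (metis bar_bar)
  show ?thesis
    by (cases k) (simp_all add: over under virtual)
qed

lemma ev_R2:
  assumes "x \<in> C" "y \<in> C"
  shows "ev [(Cross k, 0), (Cross (opp k), 0)] \<phi> (x # y # s) = \<phi> (x # y # s)"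
  using assms by (cases k) auto

text \<open>
  Self-distributivity as a rewrite rule: together with the cancellation of \<open>act x\<close> and \<open>act (bar x)\<close>
  it normalises every action to a product of actions of the given colours, which settles all cases
  of the third move.
\<close>

lemma act_act_conj:
  assumes "x \<in> C" "y \<in> C" "b \<in> C"
  shows "act (act x y) b = act x (act y (act (bar x) b))"
  using assms by (simp add: act_act[of x y])

lemma ev_R3:
  assumes "R3_admissible k12 k13 k23" "x \<in> C" "y \<in> C" "z \<in> C"
  shows "ev [(Cross k12, 0), (Cross k13, 1), (Cross k23, 0)] \<phi> (x # y # z # s)
       = ev [(Cross k23, 1), (Cross k13, 0), (Cross k12, 1)] \<phi> (x # y # z # s)"
  using assms
  by (cases k12; cases k13; cases k23) (simp_all add: R3_admissible_def act_act_conj bar_act)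

end

section \<open>Isotopy of tangle words\<close>

text \<open>
  Equality of tangles up to the local moves.  The arities on both sides are part of the relation:
  the empty word can be drawn on any number of strands, whereas the pair of crossings that replaces
  it needs two of them.
\<close>

inductive isotopic :: "nat \<Rightarrow> nat \<Rightarrow> word \<Rightarrow> word \<Rightarrow> bool" where
  move: "planar_isotopy x y \<or> reidemeister x y \<Longrightarrow> tangle m x n \<Longrightarrow> tangle m y n \<Longrightarrow> isotopic m n x y"
| refl: "tangle m x n \<Longrightarrow> isotopic m n x x"
| sym: "isotopic m n x y \<Longrightarrow> isotopic m n y x"
| trans: "isotopic m n x y \<Longrightarrow> isotopic m n y z \<Longrightarrow> isotopic m n x z"
| in_context: "tangle m u p \<Longrightarrow> isotopic p q x y \<Longrightarrow> tangle q v n \<Longrightarrow> isotopic m n (u @ x @ v) (u @ y @ v)"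

lemma isotopic_tangle: "isotopic m n x y \<Longrightarrow> tangle m x n \<and> tangle m y n"
  by (induction rule: isotopic.induct) (auto intro: tangle_appendI)

lemma isotopic_append:
  assumes "isotopic m p x x'" "isotopic p n y y'"
  shows "isotopic m n (x @ y) (x' @ y')"
proof (rule isotopic.trans)
  show "isotopic m n (x @ y) (x' @ y)"
    using isotopic.in_context[of m "[]" m p x x' y n] assms isotopic_tangle by auto
  show "isotopic m n (x' @ y) (x' @ y')"
    using isotopic.in_context[of m x' p n y y' "[]" n] assms isotopic_tangle by auto
qed

context symmetric_quandle
begin

lemma ev_shift_cong:
  assumes "i \<le> length s" "set s \<subseteq> C"
    and "\<And>\<phi> t. length t = length s - i \<Longrightarrow> set t \<subseteq> C \<Longrightarrow> ev x \<phi> t = ev y \<phi> t"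
  shows "ev (shift i x) \<phi> s = ev (shift i y) \<phi> s"
proof -
  have len: "length (take i s) = i" using assms(1) by simp
  have "set (drop i s) \<subseteq> C" using assms(2) set_drop_subset by (meson order_trans set_drop_subset)
  then have "ev (shift i x) \<phi> (take i s @ drop i s) = ev (shift i y) \<phi> (take i s @ drop i s)"
    using ev_shift[of "take i s" _ \<phi> "drop i s"] assms(3)[of "drop i s" "\<lambda>s'. \<phi> (take i s @ s')"] unfolding len by simp
  then show ?thesis by simp
qed

lemma ev_planar_isotopy:
  assumes "planar_isotopy x y" "tangle m x n" "tangle m y n" "length s = m" "set s \<subseteq> C"
  shows "ev x \<phi> s = ev y \<phi> s"
  using assms(1)
proof cases
  case (far i j p q)
  obtain k where k: "j = i + k" using far le_Suc_ex by blast
  have xy: "x = shift i [(p, 0), (q, outs p + k)]" "y = shift i [(q, ins p + k), (p, 0)]"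
    using far k by (auto simp: shift_def)
  have len: "i + ins p \<le> length s" using far assms by simp
  show ?thesis unfolding xy
  proof (rule ev_shift_cong)
    fix \<phi> and t :: "'c list" assume t: "length t = length s - i"
    then show "ev [(p, 0), (q, outs p + k)] \<phi> t = ev [(q, ins p + k), (p, 0)] \<phi> t"
      using ev_far_left[of "take (ins p) t" p q k \<phi> "drop (ins p) t"] len by simp
  qed (use len assms in auto)
next
  case (zigzag_left i)
  have len: "i + 1 \<le> length s" and xy: "x = shift i [(Cup, 0), (Cap, 1)]" "y = shift i []"
    using zigzag_left assms by (auto simp: shift_def)
  show ?thesis unfolding xy
  proof (rule ev_shift_cong)
    fix \<phi> and t :: "'c list" assume "length t = length s - i" "set t \<subseteq> C"
    with len obtain a t' where "t = a # t'" "a \<in> C" by (cases t) auto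
    then show "ev [(Cup, 0), (Cap, 1)] \<phi> t = ev [] \<phi> t" using ev_zigzag_left by simp
  qed (use len assms in auto)
next
  case (zigzag_right i)
  have len: "i + 1 \<le> length s" and xy: "x = shift i [(Cup, 1), (Cap, 0)]" "y = shift i []"
    using zigzag_right assms by (auto simp: shift_def)
  show ?thesis unfolding xy
  proof (rule ev_shift_cong)
    fix \<phi> and t :: "'c list" assume "length t = length s - i" "set t \<subseteq> C"
    with len obtain a t' where "t = a # t'" "a \<in> C" by (cases t) auto
    then show "ev [(Cup, 1), (Cap, 0)] \<phi> t = ev [] \<phi> t" using ev_zigzag_right by simp
  qed (use len assms in auto)
next
  case (slide_cup i k)
  have len: "i + 1 \<le> length s"
    and xy: "x = shift i [(Cup, 0), (Cross k, 1)]" "y = shift i [(Cup, 1), (Cross (opp k), 0)]"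
    using slide_cup assms by (auto simp: shift_def)
  show ?thesis unfolding xy
  proof (rule ev_shift_cong)
    fix \<phi> and t :: "'c list" assume "length t = length s - i" "set t \<subseteq> C"
    with len obtain a t' where "t = a # t'" "a \<in> C" by (cases t) auto
    then show "ev [(Cup, 0), (Cross k, 1)] \<phi> t = ev [(Cup, 1), (Cross (opp k), 0)] \<phi> t"
      using ev_slide_cup by simp
  qed (use len assms in auto)
next
  case (slide_cap k i)
  have len: "i + 3 \<le> length s"
    and xy: "x = shift i [(Cross k, 1), (Cap, 0)]" "y = shift i [(Cross (opp k), 0), (Cap, 1)]"
    using slide_cap assms by (auto simp: shift_def)
  show ?thesis unfolding xy
  proof (rule ev_shift_cong)
    fix \<phi> and t :: "'c list" assume "length t = length s - i" "set t \<subseteq> C"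
    with len obtain a b c t' where "t = a # b # c # t'" "a \<in> C" "b \<in> C" "c \<in> C"
      by (cases t; cases "tl t"; cases "tl (tl t)") auto
    then show "ev [(Cross k, 1), (Cap, 0)] \<phi> t = ev [(Cross (opp k), 0), (Cap, 1)] \<phi> t"
      using ev_slide_cap by simp
  qed (use len assms in auto)
qed

lemma ev_reidemeister:
  assumes "reidemeister x y" "tangle m x n" "tangle m y n" "length s = m" "set s \<subseteq> C"
  shows "ev x \<phi> s = ev y \<phi> s"
  using assms(1)
proof cases
  case (R1_cup i k)
  have len: "i \<le> length s"
    and xy: "x = shift i [(Cup, 0), (Cross k, 0)]" "y = shift i [(Cup, 0)]"
    using R1_cup assms by (auto simp: shift_def)
  show ?thesis unfolding xy
    by (rule ev_shift_cong) (use len assms ev_R1_cup in auto)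
next
  case (R1_cap k i)
  have len: "i + 2 \<le> length s"
    and xy: "x = shift i [(Cross k, 0), (Cap, 0)]" "y = shift i [(Cap, 0)]"
    using R1_cap assms by (auto simp: shift_def)
  show ?thesis unfolding xy
  proof (rule ev_shift_cong)
    fix \<phi> and t :: "'c list" assume "length t = length s - i" "set t \<subseteq> C"
    with len obtain a b t' where "t = a # b # t'" "a \<in> C" "b \<in> C"
      by (cases t; cases "tl t") auto
    then show "ev [(Cross k, 0), (Cap, 0)] \<phi> t = ev [(Cap, 0)] \<phi> t"
      using ev_R1_cap by simp
  qed (use len assms in auto)
next
  case (R2 k i)
  have len: "i + 2 \<le> length s"
    and xy: "x = shift i [(Cross k, 0), (Cross (opp k), 0)]" "y = shift i []"
    using R2 assms by (auto simp: shift_def)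
  show ?thesis unfolding xy
  proof (rule ev_shift_cong)
    fix \<phi> and t :: "'c list" assume "length t = length s - i" "set t \<subseteq> C"
    with len obtain a b t' where "t = a # b # t'" "a \<in> C" "b \<in> C"
      by (cases t; cases "tl t") auto
    then show "ev [(Cross k, 0), (Cross (opp k), 0)] \<phi> t = ev [] \<phi> t"
      using ev_R2 by simp
  qed (use len assms in auto)
next
  case (R3 k12 k13 k23 i)
  have len: "i + 3 \<le> length s"
    and xy: "x = shift i [(Cross k12, 0), (Cross k13, 1), (Cross k23, 0)]"
      "y = shift i [(Cross k23, 1), (Cross k13, 0), (Cross k12, 1)]"
    using R3 assms by (auto simp: shift_def)
  show ?thesis unfolding xy
  proof (rule ev_shift_cong)
    fix \<phi> and t :: "'c list" assume "length t = length s - i" "set t \<subseteq> C"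
    with len obtain a b c t' where "t = a # b # c # t'" "a \<in> C" "b \<in> C" "c \<in> C"
      by (cases t; cases "tl t"; cases "tl (tl t)") auto
    then show "ev [(Cross k12, 0), (Cross k13, 1), (Cross k23, 0)] \<phi> t
        = ev [(Cross k23, 1), (Cross k13, 0), (Cross k12, 1)] \<phi> t"
      using ev_R3 R3 by simp
  qed (use len assms in auto)
qed

theorem ev_isotopic: "isotopic m n x y \<Longrightarrow> length s = m \<Longrightarrow> set s \<subseteq> C \<Longrightarrow> ev x \<phi> s = ev y \<phi> s"
proof (induction arbitrary: s \<phi> rule: isotopic.induct)
  case (move x y m n)
  then show ?case using ev_planar_isotopy ev_reidemeister by blast
next
  case (in_context m u p q x y v n)
  show ?case unfolding ev_append
    by (rule ev_cong[OF in_context(1)]) (use in_context in auto)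
qed auto

end

section \<open>Connectedness by counting colourings\<close>

text \<open>
  In the trivial quandle with two elements a colouring is constant along the curve, so a diagram with
  \<open>c\<close> components has \<open>2^c\<close> colourings.
\<close>

interpretation two: symmetric_quandle "UNIV :: bool set" "\<lambda>x. x" "\<lambda>_ b. b"
  by unfold_locales auto

lemma two_cross [simp]: "two.cross k x y = [y, x]"
  by (cases k) auto

fun slice_ok :: "piece \<Rightarrow> nat \<Rightarrow> bool list \<Rightarrow> bool list \<Rightarrow> bool" where
  "slice_ok Cup i s s' \<longleftrightarrow> s' ! i = s' ! (i + 1)"
| "slice_ok Cap i s s' \<longleftrightarrow> s ! i = s ! (i + 1)"
| "slice_ok (Cross k) i s s' \<longleftrightarrow> s ! i = s' ! (i + 1) \<and> s ! (i + 1) = s' ! i"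

lemma two_left_step_iff:
  assumes "ins p \<le> length s"
  shows "s' \<in> two.left_step p s \<longleftrightarrow> length s' = length s - ins p + outs p
    \<and> (\<forall>x. ins p + x < length s \<longrightarrow> s' ! (outs p + x) = s ! (ins p + x)) \<and> slice_ok p 0 s s'"
proof -
  have eq: "t = u \<longleftrightarrow> length t = length u \<and> (\<forall>x < length u. t ! x = u ! x)" for t u :: "bool list"
    by (auto simp: list_eq_iff_nth_eq)
  have two: "(\<exists>a b u. t = a # b # u) \<longleftrightarrow> 2 \<le> length t" for t :: "bool list"
    by (cases t; cases "tl t") auto
  show ?thesis
  proof (cases p)
    case Cup
    show ?thesis
    proof (cases "2 \<le> length s'")
      case True
      then obtain a b t where s': "s' = a # b # t" using two by blast
      have "s' \<in> two.left_step p s \<longleftrightarrow> a = b \<and> t = s" using Cup s' by auto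
      then show ?thesis using Cup s' eq[of t s] by auto
    qed (use Cup in auto)
  next
    case Cap
    then obtain a b t where s: "s = a # b # t" using assms two[of s] by auto
    have "s' \<in> two.left_step p s \<longleftrightarrow> a = b \<and> s' = t" using Cap s by auto
    then show ?thesis using Cap s eq[of s' t] by auto
  next
    case (Cross k)
    then obtain a b t where s: "s = a # b # t" using assms two[of s] by auto
    show ?thesis
    proof (cases "2 \<le> length s'")
      case True
      then obtain c d t' where s': "s' = c # d # t'" using two by blast
      have "s' \<in> two.left_step p s \<longleftrightarrow> c = b \<and> d = a \<and> t' = t" using Cross s s' by auto
      then show ?thesis using Cross s s' eq[of t' t] by auto
    qed (use Cross s in auto)
  qed
qed

lemma two_step_iff:
  assumes "i + ins p \<le> length s"
  shows "s' \<in> two.step p i s \<longleftrightarrow> length s' = length s - ins p + outs p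
    \<and> (\<forall>x < i. s' ! x = s ! x)
    \<and> (\<forall>x. i + ins p + x < length s \<longrightarrow> s' ! (i + outs p + x) = s ! (i + ins p + x))
    \<and> slice_ok p i s s'"
  using assms
proof (induction i arbitrary: s s')
  case 0
  then show ?case using two_left_step_iff[of p s s'] by (simp add: two.step.simps)
next
  case (Suc i)
  then obtain a t where s: "s = a # t" by (cases s) auto
  have len: "length s - ins p + outs p = Suc (length t - ins p + outs p)"
    using Suc.prems s by simp
  have slice: "slice_ok p (Suc i) (a # t) (b # t') = slice_ok p i t t'" for b t'
    by (cases p) auto
  show ?case
  proof (cases s')
    case Nil
    then show ?thesis unfolding len by (auto simp: s two.step.simps)
  next
    case (Cons b t')
    show ?thesis
      unfolding len using Suc.IH[of t t'] Suc.prems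
      by (auto simp: s Cons two.step.simps slice All_less_Suc2)
  qed
qed

text \<open>
  The colourings themselves, as lists of the states at all heights.  They are compared with the
  functions on the points of the diagram that respect the relation \<open>joined\<close>.
\<close>

fun traces :: "word \<Rightarrow> bool list \<Rightarrow> bool list list set" where
  "traces [] s = {[s]}"
| "traces ((p, i) # w) s = (\<Union>s' \<in> two.step p i s. (#) s ` traces w s')"

lemma finite_two_step: "finite (two.step p i s)"
proof (induction p i s rule: two.step.induct)
  case (1 p s)
  then show ?case by (cases "(p, s)" rule: two.left_step.cases) (auto simp: two.step.simps)
qed (auto simp: two.step.simps)

lemma finite_traces: "finite (traces w s)"
  by (induction w s rule: traces.induct) (auto simp: finite_two_step)

lemma hd_trace: "T \<in> traces w s \<Longrightarrow> T \<noteq> [] \<and> hd T = s"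
  by (induction w s arbitrary: T rule: traces.induct) auto

lemma card_traces: "card (traces w s) = two.ev w (\<lambda>_. 1) s"
proof (induction w s rule: traces.induct)
  case (2 p i w s)
  have "card (traces ((p, i) # w) s) = (\<Sum>s' \<in> two.step p i s. card ((#) s ` traces w s'))"
    unfolding traces.simps
  proof (rule card_UN_disjoint)
    show "\<forall>s' \<in> two.step p i s. \<forall>s'' \<in> two.step p i s. s' \<noteq> s'' \<longrightarrow>
        (#) s ` traces w s' \<inter> (#) s ` traces w s'' = {}"
      by (auto dest!: hd_trace)
  qed (auto simp: finite_two_step finite_traces)
  also have "\<dots> = two.ev ((p, i) # w) (\<lambda>_. 1) s"
    using 2 by (simp add: card_image)
  finally show ?case .
qed simp

lemma trace_iff:
  "T \<in> traces w s \<longleftrightarrow> length T = Suc (length w) \<and> T ! 0 = s \<and>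
     (\<forall>t < length w. T ! Suc t \<in> two.step (fst (w ! t)) (snd (w ! t)) (T ! t))"
proof (induction w arbitrary: T s)
  case Nil
  then show ?case by (cases T) auto
next
  case (Cons a w)
  obtain p i where a: "a = (p, i)" by fastforce
  show ?case
  proof (cases T)
    case (Cons s0 T')
    then show ?thesis by (auto simp: a image_iff Cons.IH All_less_Suc2)
  qed (auto simp: a)
qed

fun width :: "nat \<Rightarrow> word \<Rightarrow> nat" where
  "width m [] = m"
| "width m ((p, i) # w) = width (m - ins p + outs p) w"

lemma tangle_width: "tangle m w n \<Longrightarrow> width m w = n"
  by (induction m w n rule: tangle.induct) auto

lemma closed_slice:
  assumes "tangle 0 w 0" "t < length w" "w ! t = (p, i)"
  defines "m \<equiv> width 0 (take t w)"
  shows "tangle 0 (take t w) m" "i + ins p \<le> m" "width 0 (take (Suc t) w) = m - ins p + outs p"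
    "tangle 0 (take (Suc t) w) (m - ins p + outs p)"
proof -
  have "w = take t w @ (p, i) # drop (Suc t) w"
    using assms(2,3) by (metis id_take_nth_drop)
  then have "tangle 0 (take t w @ (p, i) # drop (Suc t) w) 0" using assms(1) by simp
  then obtain k where k: "tangle 0 (take t w) k" "tangle k ((p, i) # drop (Suc t) w) 0"
    by (auto simp only: tangle_append)
  then have "k = m" using tangle_width m_def by blast
  then show 1: "tangle 0 (take t w) m" "i + ins p \<le> m" using k by auto
  show 2: "tangle 0 (take (Suc t) w) (m - ins p + outs p)"
    unfolding take_Suc_conv_app_nth[OF assms(2)] assms(3)
    by (rule tangle_appendI[OF 1(1)]) (use 1(2) in simp)
  show "width 0 (take (Suc t) w) = m - ins p + outs p"
    by (rule tangle_width[OF 2])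
qed

lemma points_closed:
  assumes "tangle 0 w 0"
  shows "(t, x) \<in> points w \<longleftrightarrow> t \<le> length w \<and> x < width 0 (take t w)"
proof -
  have "tangle 0 (take t w) (width 0 (take t w))" if "t \<le> length w"
  proof (cases "t = length w")
    case True
    then show ?thesis using assms tangle_width[OF assms] by simp
  next
    case False
    then show ?thesis
      using closed_slice(1)[OF assms, of t] that by (cases "w ! t") auto
  qed
  then show ?thesis by (auto simp: points_def dest: tangle_width)
qed

lemma trace_length:
  assumes "tangle 0 w 0" "T \<in> traces w []" "t \<le> length w"
  shows "length (T ! t) = width 0 (take t w)"
  using assms(3)
proof (induction t)
  case 0
  then show ?case using assms(2) by (simp add: trace_iff)
next
  case (Suc t)
  obtain p i where pi: "w ! t = (p, i)" by fastforce
  have "T ! Suc t \<in> two.step p i (T ! t)"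
    using assms(2) Suc.prems pi unfolding trace_iff by (metis Suc_le_lessD fst_conv snd_conv)
  then show ?case
    using Suc closed_slice(3)[OF assms(1) _ pi] two.step_length by simp
qed

text \<open>
  The relation \<open>joined\<close> also relates pairs to the right of the diagram, which are not points; it never
  leads from a point to such a pair.
\<close>

lemma trace_joined:
  assumes "tangle 0 w 0" "T \<in> traces w []" "joined w a b"
  shows "(a \<in> points w \<longleftrightarrow> b \<in> points w) \<and>
    (a \<in> points w \<longrightarrow> T ! fst a ! snd a = T ! fst b ! snd b)"
proof -
  have slice: "i + ins p \<le> width 0 (take t w)"
      "width 0 (take (Suc t) w) = width 0 (take t w) - ins p + outs p"
      "length (T ! t) = width 0 (take t w)"
      "length (T ! Suc t) = width 0 (take (Suc t) w)"
      "(\<forall>x < i. T ! Suc t ! x = T ! t ! x)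
      \<and> (\<forall>x. i + ins p + x < length (T ! t) \<longrightarrow> T ! Suc t ! (i + outs p + x) = T ! t ! (i + ins p + x))
      \<and> slice_ok p i (T ! t) (T ! Suc t)"
    if "t < length w" "w ! t = (p, i)" for t p i
  proof -
    show 1: "i + ins p \<le> width 0 (take t w)"
      "width 0 (take (Suc t) w) = width 0 (take t w) - ins p + outs p"
      using closed_slice[OF assms(1) that] by auto
    show 2: "length (T ! t) = width 0 (take t w)"
      "length (T ! Suc t) = width 0 (take (Suc t) w)"
      using trace_length[OF assms(1,2)] that by auto
    have "T ! Suc t \<in> two.step p i (T ! t)"
      using assms(2) that by (auto simp: trace_iff)
    then show "(\<forall>x < i. T ! Suc t ! x = T ! t ! x)
      \<and> (\<forall>x. i + ins p + x < length (T ! t) \<longrightarrow> T ! Suc t ! (i + outs p + x) = T ! t ! (i + ins p + x))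
      \<and> slice_ok p i (T ! t) (T ! Suc t)"
      using two_step_iff[of i p "T ! t" "T ! Suc t"] 1 2 by auto
  qed
  from assms(3) show ?thesis
  proof cases
    case (left t p i x)
    then show ?thesis using slice[OF left(3,4)] by (auto simp: points_closed[OF assms(1)])
  next
    case (right t p i x)
    then show ?thesis using slice[OF right(3,4)] by (auto simp: points_closed[OF assms(1)])
  next
    case (cup t i)
    then show ?thesis using slice[OF cup(3,4)] by (auto simp: points_closed[OF assms(1)])
  next
    case (cap t i)
    then show ?thesis using slice[OF cap(3,4)] by (auto simp: points_closed[OF assms(1)])
  next
    case (rising t k i)
    then show ?thesis using slice[OF rising(3,4)] by (auto simp: points_closed[OF assms(1)])
  next
    case (falling t k i)
    then show ?thesis using slice[OF falling(3,4)] by (auto simp: points_closed[OF assms(1)])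
  qed
qed

lemma trace_equivclp:
  assumes "tangle 0 w 0" "T \<in> traces w []" "equivclp (joined w) a b" "a \<in> points w"
  shows "b \<in> points w \<and> T ! fst b ! snd b = T ! fst a ! snd a"
  using assms(3)
proof (induction rule: equivclp_induct)
  case base
  then show ?case using assms(4) by simp
next
  case (step y z)
  then show ?case using trace_joined[OF assms(1,2), of y z] trace_joined[OF assms(1,2), of z y] by auto
qed

lemma trace_of_function:
  assumes "tangle 0 w 0" and inv: "\<And>a b. joined w a b \<Longrightarrow> f a = f b"
  shows "map (\<lambda>t. map (\<lambda>x. f (t, x)) [0..<width 0 (take t w)]) [0..<Suc (length w)] \<in> traces w []"
    (is "?T \<in> _")
  unfolding trace_iff
proof (intro conjI allI impI)
  fix t assume t: "t < length w"
  obtain p i where pi: "w ! t = (p, i)" by fastforce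
  have nth: "?T ! t' = map (\<lambda>x. f (t', x)) [0..<width 0 (take t' w)]" if "t' \<le> length w" for t'
  proof -
    have "[0..<Suc (length w)] ! t' = t'" using that nth_upt[of 0 t' "Suc (length w)"] by simp
    then show ?thesis using that by (simp del: upt_Suc)
  qed
  note slice = closed_slice[OF assms(1) t pi]
  have "slice_ok p i (?T ! t) (?T ! Suc t)"
  proof (cases p)
    case Cup
    then show ?thesis
      using slice inv[OF joined.cup[OF t, of i]] pi nth[of t] nth[of "Suc t"] t by (simp del: upt_Suc)
  next
    case Cap
    then show ?thesis
      using slice inv[OF joined.cap[OF t, of i]] pi nth[of t] nth[of "Suc t"] t by (simp del: upt_Suc)
  next
    case (Cross k)
    then show ?thesis
      using slice inv[OF joined.rising[OF t, of k i]] inv[OF joined.falling[OF t, of k i]]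
        pi nth[of t] nth[of "Suc t"] t by (simp del: upt_Suc)
  qed
  then show "?T ! Suc t \<in> two.step (fst (w ! t)) (snd (w ! t)) (?T ! t)"
    using slice t inv[OF joined.left[OF t pi]] inv[OF joined.right[OF t pi]] nth[of t] nth[of "Suc t"]
    by (simp add: pi two_step_iff del: upt_Suc)
qed (simp_all del: upt_Suc)

text \<open>
  If any two points are connected, then only the two constant colourings exist.  Conversely, being
  connected to a fixed point is itself a colouring; if it is constant, all points are connected to
  that point.
\<close>

lemma one_component_iff_card_traces:
  assumes tan: "tangle 0 w 0"
  shows "one_component w \<longleftrightarrow> card (traces w []) = 2"
proof -
  let ?K = "\<lambda>c. map (\<lambda>t. map (\<lambda>x. c) [0..<width 0 (take t w)]) [0..<Suc (length w)]"
  have K: "?K c \<in> traces w []" for c :: bool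
    using trace_of_function[OF tan, of "\<lambda>_. c"] by simp
  have value_K: "?K c ! t ! x = c" if "(t, x) \<in> points w" for c :: bool and t x
    using that by (auto simp: points_closed[OF tan] simp del: upt_Suc)
  have monochrome: "T = ?K c" if "T \<in> traces w []" "\<And>t x. (t, x) \<in> points w \<Longrightarrow> T ! t ! x = c" for T c
  proof (rule nth_equalityI)
    show len: "length T = length (?K c)" using that(1) by (simp add: trace_iff)
    fix t assume "t < length T"
    then have t: "t \<le> length w" using that(1) by (simp add: trace_iff)
    then have "?K c ! t = map (\<lambda>x. c) [0..<width 0 (take t w)]" 
      using nth_upt[of 0 t "Suc (length w)"] by (simp del: upt_Suc)
    then show "T ! t = ?K c ! t"
      using that(2)[of t] trace_length[OF tan that(1) t] t
      by (auto simp: points_closed[OF tan] intro!: nth_equalityI)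
  qed
  have neq: "?K True \<noteq> ?K False" if "points w \<noteq> {}"
    using that value_K by (metis ex_in_conv surj_pair)
  show ?thesis
  proof
    assume one: "one_component w"
    then have ne: "points w \<noteq> {}" by (simp add: one_component_def)
    then obtain a where a: "a \<in> points w" by blast
    have "traces w [] = {?K True, ?K False}"
    proof (intro equalityI subsetI)
      fix T assume T: "T \<in> traces w []"
      have "T = ?K (T ! fst a ! snd a)"
      proof (rule monochrome[OF T])
        fix t x assume "(t, x) \<in> points w"
        then have "equivclp (joined w) a (t, x)" using one a by (auto simp: one_component_def)
        from trace_equivclp[OF tan T this a] show "T ! t ! x = T ! fst a ! snd a" by simp
      qed
      then show "T \<in> {?K True, ?K False}" by (cases "T ! fst a ! snd a") auto
    qed (use K in auto)
    then show "card (traces w []) = 2" using neq[OF ne] by simp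
  next
    assume card: "card (traces w []) = 2"
    then have "w \<noteq> []" by auto
    then obtain p i w' where w: "w = (p, i) # w'" by (cases w) auto
    then have "p = Cup" using tan by (cases p) auto
    then have "(1, 0) \<in> points w" unfolding points_closed[OF tan] using w by simp
    then have ne: "points w \<noteq> {}" by blast
    have "{?K True, ?K False} = traces w []"
      using K card neq[OF ne] finite_traces
      by (intro card_subset_eq) auto
    then have const: "\<exists>c. T = ?K c" if "T \<in> traces w []" for T using that by blast
    have "equivclp (joined w) a b" if a: "a \<in> points w" and b: "b \<in> points w" for a b
    proof -
      let ?f = "\<lambda>b. equivclp (joined w) a b"
      let ?T = "map (\<lambda>t. map (\<lambda>x. ?f (t, x)) [0..<width 0 (take t w)]) [0..<Suc (length w)]"
      \<comment> \<open>The component of \<open>a\<close> gets one colour and the rest of the diagram the other.\<close>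
      have "?T \<in> traces w []"
        by (rule trace_of_function[OF tan])
          (meson equivclp_sym equivclp_trans r_into_equivclp)
      then obtain c where c: "?T = ?K c" using const by blast
      have T: "?T ! t ! x = ?f (t, x)" if "(t, x) \<in> points w" for t x
        using that nth_upt[of 0 t "Suc (length w)"] by (auto simp: points_closed[OF tan] simp del: upt_Suc)
      have "?f (t, x) = c" if p: "(t, x) \<in> points w" for t x
      proof -
        have "?f (t, x) = ?T ! t ! x" using T[OF p] by (rule HOL.sym)
        also have "\<dots> = ?K c ! t ! x" unfolding c ..
        also have "\<dots> = c" using value_K[OF p] .
        finally show ?thesis .
      qed
      then show ?thesis using a b by (metis equivclp_refl surj_pair)
    qed
    then show "one_component w" using ne by (simp add: one_component_def)
  qed
qed

theorem is_diagram_iff: "is_diagram w \<longleftrightarrow> tangle 0 w 0 \<and> two.ev w (\<lambda>_. 1) [] = 2"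
  using one_component_iff_card_traces by (auto simp: is_diagram_def card_traces)

section \<open>Isotopy and arc shifts of diagrams\<close>

definition knot_of :: "word \<Rightarrow> virtual_knot" where
  "knot_of w = abs_virtual_knot (Abs_diagram w)"

lemma Rep_Abs: "is_diagram w \<Longrightarrow> Rep_diagram (Abs_diagram w) = w"
  by (simp add: Abs_diagram_inverse)

lemma knot_of_Rep: "knot_of (Rep_diagram D) = abs_virtual_knot D"
  by (simp add: knot_of_def Rep_diagram_inverse)

lemma isotopic_context_is_diagram:
  assumes "isotopic m n x y" "tangle 0 u m" "tangle n v 0"
  shows "is_diagram (u @ x @ v) \<longleftrightarrow> is_diagram (u @ y @ v)"
proof -
  have t: "isotopic 0 0 (u @ x @ v) (u @ y @ v)" using assms by (blast intro: isotopic.in_context)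
  show ?thesis unfolding is_diagram_iff
    using isotopic_tangle[OF t] two.ev_isotopic[OF t, of "[]"] by simp
qed

text \<open>
  The context \<open>u\<close>, \<open>v\<close> makes the induction possible: it is extended when the isotopy takes place
  inside a larger tangle.
\<close>

lemma isotopic_context_knot_of:
  assumes "isotopic m n x y" "tangle 0 u m" "tangle n v 0" "is_diagram (u @ x @ v)"
  shows "knot_of (u @ x @ v) = knot_of (u @ y @ v)"
  using assms
proof (induction arbitrary: u v rule: isotopic.induct)
  case (move x y m n)
  have "isotopic m n x y" using move by (intro isotopic.move)
  then have "is_diagram (u @ y @ v)" using isotopic_context_is_diagram move by blast
  then have "generalized_move (Abs_diagram (u @ x @ v)) (Abs_diagram (u @ y @ v))"
    using move unfolding generalized_move_def locally_def by (metis Rep_Abs)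
  then show ?case
    unfolding knot_of_def virtual_knot.abs_eq_iff by (rule r_into_equivclp)
next
  case (sym m n x y)
  then show ?case using isotopic_context_is_diagram[OF sym(1)] by metis
next
  case (trans m n x y z)
  then show ?case using isotopic_context_is_diagram[OF trans(1)] by metis
next
  case (in_context m u' p q x y v' n)
  have "tangle 0 (u @ u') p" "tangle q (v' @ v) 0"
    using in_context by (auto intro: tangle_appendI)
  then show ?case using in_context.IH[of "u @ u'" "v' @ v"] in_context.prems by simp
qed simp

theorem isotopic_knot_of: "isotopic 0 0 w w' \<Longrightarrow> is_diagram w \<Longrightarrow> knot_of w = knot_of w'"
  using isotopic_context_knot_of[of 0 0 w w' "[]" "[]"] by simp

theorem isotopic_is_diagram: "isotopic 0 0 w w' \<Longrightarrow> is_diagram w \<longleftrightarrow> is_diagram w'"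
  using isotopic_context_is_diagram[of 0 0 w w' "[]" "[]"] by simp

lemma move_same_end: "planar_isotopy w w' \<or> reidemeister w w' \<Longrightarrow> tangle m w n \<Longrightarrow> tangle m w' n' \<Longrightarrow> n = n'"
  apply (erule disjE)
   apply (erule planar_isotopy.cases; auto)
  apply (erule reidemeister.cases; auto)
  done

context symmetric_quandle
begin

lemma ev_generalized_move:
  assumes "generalized_move D D'"
  shows "ev (Rep_diagram D) \<phi> [] = ev (Rep_diagram D') \<phi> []"
proof -
  have tan: "tangle 0 (Rep_diagram D) 0" for D
    using Rep_diagram[of D] by (simp add: is_diagram_def)
  obtain u v w w' where R: "planar_isotopy w w' \<or> reidemeister w w'"
    and D: "Rep_diagram D = u @ w @ v" "Rep_diagram D' = u @ w' @ v"
    using assms by (auto simp: generalized_move_def locally_def)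
  obtain m n where m: "tangle 0 u m" "tangle m w n" "tangle n v 0"
    using tan[of D] D by (auto simp: tangle_append)
  obtain m' n' where m': "tangle 0 u m'" "tangle m' w' n'" "tangle n' v 0"
    using tan[of D'] D by (auto simp: tangle_append)
  have "m' = m" using m m' tangle_unique by blast
  then have "n' = n" using move_same_end[OF R] m m' by blast
  then have "isotopic 0 0 (u @ w @ v) (u @ w' @ v)"
    using R m m' \<open>m' = m\<close> by (blast intro: isotopic.in_context isotopic.move)
  then show ?thesis using D ev_isotopic by simp
qed

end

lemma isotopic_R2: "i + 2 \<le> m \<Longrightarrow> isotopic m m [(Cross k, i), (Cross (opp k), i)] []"
  by (rule isotopic.move) (auto intro: reidemeister.intros)

text \<open>
  The invariant by which knots will be distinguished.
\<close>

lemma colourings_eq: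
  assumes "symmetric_quandle C bar act" "is_diagram w" "is_diagram w'" "knot_of w = knot_of w'"
  shows "symmetric_quandle.ev C bar act w \<phi> [] = symmetric_quandle.ev C bar act w' \<phi> []"
proof -
  interpret symmetric_quandle C bar act by fact
  have "equivclp generalized_move (Abs_diagram w) (Abs_diagram w')"
    using assms(4) by (simp add: knot_of_def virtual_knot.abs_eq_iff)
  then have "ev (Rep_diagram (Abs_diagram w)) \<phi> [] = ev (Rep_diagram (Abs_diagram w')) \<phi> []"
    by (induction rule: equivclp_induct) (metis ev_generalized_move)+
  then show ?thesis using assms by (simp add: Rep_Abs)
qed

text \<open>
  The sign change of one classical crossing.  The two virtual crossings make the upper strand of the
  old crossing also the upper strand of the new one.  The bound \<open>i + 3\<close> provides a third strand, with
  which the arc makes its second, virtual crossing.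
\<close>

definition flip :: "nat \<Rightarrow> nat \<Rightarrow> word \<Rightarrow> word \<Rightarrow> bool" where
  "flip m n w w' \<longleftrightarrow> (\<exists>u v k i p. w = u @ [(Cross k, i)] @ v
     \<and> w' = u @ [(Cross Virtual, i), (Cross (opp k), i), (Cross Virtual, i)] @ v
     \<and> tangle m u p \<and> i + 3 \<le> p \<and> tangle p v n)"

lemma flip_in_context:
  assumes "tangle m u p" "flip p q x y" "tangle q v n"
  shows "flip m n (u @ x @ v) (u @ y @ v)"
proof -
  obtain u' v' k i p' where "x = u' @ [(Cross k, i)] @ v'"
    "y = u' @ [(Cross Virtual, i), (Cross (opp k), i), (Cross Virtual, i)] @ v'"
    "tangle p u' p'" "i + 3 \<le> p'" "tangle p' v' q"
    using assms(2) unfolding flip_def by blast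
  moreover from this have "tangle m (u @ u') p'" "tangle p' (v' @ v) n"
    using assms by (auto intro: tangle_appendI)
  ultimately show ?thesis
    unfolding flip_def
    by (intro exI[of _ "u @ u'"] exI[of _ "v' @ v"] exI[of _ k] exI[of _ i] exI[of _ p']) simp
qed

text \<open>
  The number of components does not depend on the tags.  When all tags are virtual, the two sides of
  a flip differ by a second Reidemeister move, so a flip preserves diagrams.
\<close>

fun virtualise :: "piece \<times> nat \<Rightarrow> piece \<times> nat" where
  "virtualise (Cross k, i) = (Cross Virtual, i)"
| "virtualise a = a"

lemma two_step_virtual: "two.step (Cross k) i s = two.step (Cross Virtual) i s"
proof (induction i arbitrary: s)
  case 0
  show ?case by (cases s; cases "tl s") (auto simp: two.step.simps)
next
  case (Suc i)
  then show ?case by (cases s) (auto simp: two.step.simps)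
qed

lemma two_ev_virtualise: "two.ev (map virtualise w) \<phi> s = two.ev w \<phi> s"
proof (induction w arbitrary: s)
  case (Cons a w)
  obtain p i where a: "a = (p, i)" by fastforce
  have "two.step (fst (virtualise a)) (snd (virtualise a)) s = two.step p i s"
    using a two_step_virtual[of _ i s] by (cases p) auto
  moreover obtain p' i' where "virtualise a = (p', i')" by fastforce
  ultimately show ?case using Cons a by simp
qed simp

lemma tangle_virtualise: "tangle m (map virtualise w) n \<longleftrightarrow> tangle m w n"
proof (induction w arbitrary: m)
  case (Cons a w)
  then show ?case by (cases a rule: virtualise.cases) simp_all
qed simp

lemma is_diagram_virtualise: "is_diagram (map virtualise w) \<longleftrightarrow> is_diagram w"
  by (simp add: is_diagram_iff tangle_virtualise two_ev_virtualise)

lemma is_diagram_flip: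
  assumes "flip 0 0 w w'"
  shows "is_diagram w' \<longleftrightarrow> is_diagram w"
proof -
  obtain u v k i p where w: "w = u @ [(Cross k, i)] @ v"
    "w' = u @ [(Cross Virtual, i), (Cross (opp k), i), (Cross Virtual, i)] @ v"
    and tan: "tangle 0 u p" "i + 3 \<le> p" "tangle p v 0"
    using assms unfolding flip_def by blast
  have p: "Suc (Suc (p - 2)) = p" using tan(2) by simp
  let ?V = "map virtualise"
  have "isotopic p p [(Cross Virtual, i), (Cross Virtual, i)] []"
    using tan isotopic_R2[of i p Virtual] by simp
  then have "is_diagram (?V u @ [(Cross Virtual, i), (Cross Virtual, i)] @ [(Cross Virtual, i)] @ ?V v)
      \<longleftrightarrow> is_diagram (?V u @ [] @ [(Cross Virtual, i)] @ ?V v)"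
    by (rule isotopic_context_is_diagram) (use tan in \<open>simp_all add: tangle_virtualise p\<close>)
  then have "is_diagram (?V w') \<longleftrightarrow> is_diagram (?V w)" using w by simp
  then show ?thesis by (simp only: is_diagram_virtualise)
qed

text \<open>
  A virtual second move creates two crossings with the strand on the right.  The arc shift is applied
  to the crossing in question and the first of these; afterwards the additional virtual crossings
  cancel in pairs.
\<close>

theorem shift_step_flip:
  assumes "flip 0 0 w w'" "is_diagram w"
  shows "shift_step (knot_of w) (knot_of w')"
proof -
  obtain u v k i p where w: "w = u @ [(Cross k, i)] @ v"
    "w' = u @ [(Cross Virtual, i), (Cross (opp k), i), (Cross Virtual, i)] @ v"
    and tan: "tangle 0 u p" "i + 3 \<le> p" "tangle p v 0"
    using assms(1) unfolding flip_def by blast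
  have p: "Suc (Suc (p - 2)) = p" using tan(2) by simp
  let ?V = "\<lambda>i. (Cross Virtual, i)"
  let ?w1 = "u @ [(Cross k, i), ?V (i + 1)] @ [?V (i + 1)] @ v"
  let ?w2 = "u @ [?V i, ?V (i + 1), ?V (i + 1), (Cross (opp k), i), ?V i, ?V (i + 1)]
      @ [?V (i + 1)] @ v"
  have R2: "isotopic p p [?V (i + 1), ?V (i + 1)] []"
    using tan isotopic_R2[of "i + 1" p Virtual] by simp
  have t1: "isotopic 0 0 ((u @ [(Cross k, i)]) @ [?V (i + 1), ?V (i + 1)] @ v) ((u @ [(Cross k, i)]) @ [] @ v)"
    by (rule isotopic.in_context[OF _ R2]) (use tan in \<open>auto intro!: tangle_appendI[of _ u p] simp: p\<close>)
  then have 1: "is_diagram ?w1" "knot_of ?w1 = knot_of w"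
    using isotopic_is_diagram[OF t1] isotopic_knot_of[OF t1] assms(2) w by auto
  have "isotopic 0 0 ((u @ [?V i]) @ [?V (i + 1), ?V (i + 1)] @ [(Cross (opp k), i), ?V i, ?V (i + 1), ?V (i + 1)] @ v)
      ((u @ [?V i]) @ [] @ [(Cross (opp k), i), ?V i, ?V (i + 1), ?V (i + 1)] @ v)"
    by (rule isotopic.in_context[OF _ R2]) (use tan in \<open>auto intro!: tangle_appendI[of _ u p] simp: p\<close>)
  moreover have "isotopic 0 0 ((u @ [?V i, (Cross (opp k), i), ?V i]) @ [?V (i + 1), ?V (i + 1)] @ v)
      ((u @ [?V i, (Cross (opp k), i), ?V i]) @ [] @ v)"
    by (rule isotopic.in_context[OF _ R2]) (use tan in \<open>auto intro!: tangle_appendI[of _ u p] simp: p\<close>)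
  ultimately have t2: "isotopic 0 0 ?w2 w'"
    using w by (auto intro: isotopic.trans)
  then have 2: "is_diagram ?w2" "knot_of ?w2 = knot_of w'"
    using isotopic_is_diagram[OF t2] isotopic_knot_of[OF t2] is_diagram_flip[OF assms(1)] assms(2) by auto
  have "arc_shift [(Cross k, i), ?V (i + 1)]
      [?V i, ?V (i + 1), ?V (i + 1), (Cross (opp k), i), ?V i, ?V (i + 1)]"
    using arc_shift.rightward[of k i Virtual] by simp
  then have "locally arc_shift (Abs_diagram ?w1) (Abs_diagram ?w2)"
    unfolding locally_def Rep_Abs[OF 1(1)] Rep_Abs[OF 2(1)] by blast
  then show ?thesis
    unfolding shift_step_def using 1(2) 2(2) unfolding knot_of_def by blast
qed

text \<open>
  Flipping the middle one of the three new crossings yields four virtual crossings around the original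
  one, which cancel.
\<close>

theorem shift_step_unflip:
  assumes "flip 0 0 w w'" "is_diagram w"
  shows "shift_step (knot_of w') (knot_of w)"
proof -
  obtain u v k i p where w: "w = u @ [(Cross k, i)] @ v"
    "w' = u @ [(Cross Virtual, i), (Cross (opp k), i), (Cross Virtual, i)] @ v"
    and tan: "tangle 0 u p" "i + 3 \<le> p" "tangle p v 0"
    using assms(1) unfolding flip_def by blast
  have p: "Suc (Suc (p - 2)) = p" using tan(2) by simp
  let ?V = "(Cross Virtual, i)"
  let ?w2 = "u @ [?V, ?V, (Cross k, i), ?V, ?V] @ v"
  have opp: "opp (opp k) = k" by (cases k) auto
  have "flip 0 0 ((u @ [?V]) @ [(Cross (opp k), i)] @ [?V] @ v)
      ((u @ [?V]) @ [?V, (Cross (opp (opp k)), i), ?V] @ [?V] @ v)"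
    unfolding flip_def
    using tan by (intro exI[of _ "u @ [?V]"] exI[of _ "[?V] @ v"] exI[of _ "opp k"] exI[of _ i] exI[of _ p])
      (auto intro!: tangle_appendI[of _ u p] simp: p)
  then have fl: "flip 0 0 w' ?w2" using w opp by simp
  have dia': "is_diagram w'" using is_diagram_flip[OF assms(1)] assms(2) by simp
  have R2: "isotopic p p [?V, ?V] []" using tan isotopic_R2[of i p Virtual] by simp
  have "isotopic 0 0 (u @ [?V, ?V] @ [(Cross k, i), ?V, ?V] @ v) (u @ [] @ [(Cross k, i), ?V, ?V] @ v)"
    by (rule isotopic.in_context[OF _ R2]) (use tan in \<open>auto intro!: tangle_appendI[of _ u p] simp: p\<close>)
  moreover have "isotopic 0 0 ((u @ [(Cross k, i)]) @ [?V, ?V] @ v) ((u @ [(Cross k, i)]) @ [] @ v)"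
    by (rule isotopic.in_context[OF _ R2]) (use tan in \<open>auto intro!: tangle_appendI[of _ u p] simp: p\<close>)
  ultimately have t: "isotopic 0 0 ?w2 w" using w by (auto intro: isotopic.trans)
  have "is_diagram ?w2" using is_diagram_flip[OF fl] dia' by simp
  then have "knot_of ?w2 = knot_of w" by (rule isotopic_knot_of[OF t])
  then show ?thesis using shift_step_flip[OF fl dia'] by simp
qed

lemma d_A_eq_1: "shift_step K K' \<Longrightarrow> K \<noteq> K' \<Longrightarrow> d_A K K' = 1"
proof -
  assume step: "shift_step K K'" and neq: "K \<noteq> K'"
  let ?N = "enat ` {n. (shift_step ^^ n) K K'}"
  have "(shift_step ^^ 1) K K'" using step by auto
  then have "enat 1 \<in> ?N" by blast
  then have "Inf ?N \<le> enat 1" by (rule Inf_lower)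
  moreover have "enat 1 \<le> Inf ?N"
  proof (rule Inf_greatest)
    fix x assume "x \<in> ?N"
    then obtain n where n: "x = enat n" "(shift_step ^^ n) K K'" by blast
    with neq have "n \<noteq> 0" by (cases n) auto
    then show "enat 1 \<le> x" using n by simp
  qed
  ultimately show ?thesis unfolding d_A_def by (simp add: one_enat_def)
qed

section \<open>Rewriting words\<close>

declare isotopic.trans [trans]

lemma isotopic_rewrite:
  assumes "planar_isotopy x y \<or> reidemeister x y"
    and "tangle m u p" "tangle p x q" "tangle p y q" "tangle q v n"
  shows "isotopic m n (u @ x @ v) (u @ y @ v)"
  using assms by (blast intro: isotopic.in_context isotopic.move)

lemma isotopic_rewrite_back:
  assumes "planar_isotopy x y \<or> reidemeister x y"
    and "tangle m u p" "tangle p x q" "tangle p y q" "tangle q v n"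
  shows "isotopic m n (u @ y @ v) (u @ x @ v)"
  using isotopic_rewrite[OF assms] by (rule isotopic.sym)

text \<open>
  The following chains of moves concern the words that are defined in the next section; they are
  spelled out letter by letter.  Here a strand sweeps below both legs of a minimum and is pulled off
  below it.
\<close>

lemma isotopic_Cup_sweep:
  "isotopic 4 6 [(Cup, 3), (Cross Virtual, 4), (Cross Virtual, 3), (Cross Under, 3), (Cross Under, 4)] [(Cup, 3)]"
proof -
  have "isotopic 4 6 [(Cup, 3), (Cross Virtual, 4), (Cross Virtual, 3), (Cross Under, 3), (Cross Under, 4)] [(Cup, 4), (Cross Virtual, 3), (Cross Virtual, 3), (Cross Under, 3), (Cross Under, 4)]"
    using isotopic_rewrite[OF disjI1[OF planar_isotopy.slide_cup[of 3 Virtual]], of 4 "[]" 4 6 "[(Cross Virtual, 3), (Cross Under, 3), (Cross Under, 4)]" 6] by simp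
  also have "isotopic 4 6 \<dots> [(Cup, 4), (Cross Under, 3), (Cross Under, 4)]"
    using isotopic_rewrite[OF disjI2[OF reidemeister.R2[of Virtual 3]], of 4 "[(Cup, 4)]" 6 6 "[(Cross Under, 3), (Cross Under, 4)]" 6] by simp
  also have "isotopic 4 6 \<dots> [(Cup, 3), (Cross Over, 4), (Cross Under, 4)]"
    using isotopic_rewrite_back[OF disjI1[OF planar_isotopy.slide_cup[of 3 Over]], of 4 "[]" 4 6 "[(Cross Under, 4)]" 6] by simp
  also have "isotopic 4 6 \<dots> [(Cup, 3)]"
    using isotopic_rewrite[OF disjI2[OF reidemeister.R2[of Over 4]], of 4 "[(Cup, 3)]" 6 6 "[]" 6] by simp
  finally show ?thesis .
qed

lemma isotopic_Cup_unsweep: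
  "isotopic 4 6 [(Cup, 3), (Cross Over, 4), (Cross Over, 3), (Cross Virtual, 3), (Cross Virtual, 4)] [(Cup, 3)]"
proof -
  have "isotopic 4 6 [(Cup, 3), (Cross Over, 4), (Cross Over, 3), (Cross Virtual, 3), (Cross Virtual, 4)] [(Cup, 4), (Cross Under, 3), (Cross Over, 3), (Cross Virtual, 3), (Cross Virtual, 4)]"
    using isotopic_rewrite[OF disjI1[OF planar_isotopy.slide_cup[of 3 Over]], of 4 "[]" 4 6 "[(Cross Over, 3), (Cross Virtual, 3), (Cross Virtual, 4)]" 6] by simp
  also have "isotopic 4 6 \<dots> [(Cup, 4), (Cross Virtual, 3), (Cross Virtual, 4)]"
    using isotopic_rewrite[OF disjI2[OF reidemeister.R2[of Under 3]], of 4 "[(Cup, 4)]" 6 6 "[(Cross Virtual, 3), (Cross Virtual, 4)]" 6] by simp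
  also have "isotopic 4 6 \<dots> [(Cup, 3), (Cross Virtual, 4), (Cross Virtual, 4)]"
    using isotopic_rewrite_back[OF disjI1[OF planar_isotopy.slide_cup[of 3 Virtual]], of 4 "[]" 4 6 "[(Cross Virtual, 4)]" 6] by simp
  also have "isotopic 4 6 \<dots> [(Cup, 3)]"
    using isotopic_rewrite[OF disjI2[OF reidemeister.R2[of Virtual 4]], of 4 "[(Cup, 3)]" 6 6 "[]" 6] by simp
  finally show ?thesis .
qed

text \<open>
  The legs of a minimum untwist, one crossing at a time.
\<close>

lemma isotopic_Cup_clasp:
  "isotopic 4 6 [(Cup, 3), (Cross Virtual, 3), (Cross Over, 3), (Cross Virtual, 3), (Cross Over, 3)] [(Cup, 3)]"
proof -
  have "isotopic 4 6 [(Cup, 3), (Cross Virtual, 3), (Cross Over, 3), (Cross Virtual, 3), (Cross Over, 3)] [(Cup, 3), (Cross Over, 3), (Cross Virtual, 3), (Cross Over, 3)]"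
    using isotopic_rewrite[OF disjI2[OF reidemeister.R1_cup[of 3 Virtual]], of 4 "[]" 4 6 "[(Cross Over, 3), (Cross Virtual, 3), (Cross Over, 3)]" 6] by simp
  also have "isotopic 4 6 \<dots> [(Cup, 3), (Cross Virtual, 3), (Cross Over, 3)]"
    using isotopic_rewrite[OF disjI2[OF reidemeister.R1_cup[of 3 Over]], of 4 "[]" 4 6 "[(Cross Virtual, 3), (Cross Over, 3)]" 6] by simp
  also have "isotopic 4 6 \<dots> [(Cup, 3), (Cross Over, 3)]"
    using isotopic_rewrite[OF disjI2[OF reidemeister.R1_cup[of 3 Virtual]], of 4 "[]" 4 6 "[(Cross Over, 3)]" 6] by simp
  also have "isotopic 4 6 \<dots> [(Cup, 3)]"
    using isotopic_rewrite[OF disjI2[OF reidemeister.R1_cup[of 3 Over]], of 4 "[]" 4 6 "[]" 6] by simp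
  finally show ?thesis .
qed

lemma isotopic_straighten:
  "isotopic 3 3 [(Cup, 3), (Cross Virtual, 2), (Cap, 3)] []"
proof -
  have "isotopic 3 3 [(Cup, 3), (Cross Virtual, 2), (Cap, 3)] [(Cup, 2), (Cross Virtual, 3), (Cap, 3)]"
    using isotopic_rewrite_back[OF disjI1[OF planar_isotopy.slide_cup[of 2 Virtual]], of 3 "[]" 3 5 "[(Cap, 3)]" 3] by simp
  also have "isotopic 3 3 \<dots> [(Cup, 2), (Cap, 3)]"
    using isotopic_rewrite[OF disjI2[OF reidemeister.R1_cap[of Virtual 3]], of 3 "[(Cup, 2)]" 5 3 "[]" 3] by simp
  also have "isotopic 3 3 \<dots> []"
    using isotopic_rewrite[OF disjI1[OF planar_isotopy.zigzag_left[of 2]], of 3 "[]" 3 3 "[]" 3] by simp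
  finally show ?thesis .
qed

text \<open>
  Joining the two strands of the core leaves one chord between the remaining two strands.
\<close>

lemma isotopic_join_core:
  "isotopic 3 3 [(Cup, 3), (Cross Virtual, 2), (Cross Over, 1), (Cross Virtual, 1), (Cross Virtual, 2), (Cross Virtual, 2), (Cap, 3)] [(Cross Over, 1), (Cross Virtual, 1)]"
proof -
  have "isotopic 3 3 [(Cup, 3), (Cross Virtual, 2), (Cross Over, 1), (Cross Virtual, 1), (Cross Virtual, 2), (Cross Virtual, 2), (Cap, 3)] [(Cup, 3), (Cross Virtual, 2), (Cross Over, 1), (Cross Virtual, 1), (Cap, 3)]"
    using isotopic_rewrite[OF disjI2[OF reidemeister.R2[of Virtual 2]], of 3 "[(Cup, 3), (Cross Virtual, 2), (Cross Over, 1), (Cross Virtual, 1)]" 5 5 "[(Cap, 3)]" 3] by simp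
  also have "isotopic 3 3 \<dots> [(Cup, 2), (Cross Virtual, 3), (Cross Over, 1), (Cross Virtual, 1), (Cap, 3)]"
    using isotopic_rewrite_back[OF disjI1[OF planar_isotopy.slide_cup[of 2 Virtual]], of 3 "[]" 3 5 "[(Cross Over, 1), (Cross Virtual, 1), (Cap, 3)]" 3] by simp
  also have "isotopic 3 3 \<dots> [(Cup, 2), (Cross Over, 1), (Cross Virtual, 3), (Cross Virtual, 1), (Cap, 3)]"
    using isotopic_rewrite_back[OF disjI1[OF planar_isotopy.far[where i = 1 and j = 1 and p = "Cross Over" and q = "Cross Virtual", OF order_refl]], of 3 "[(Cup, 2)]" 5 5 "[(Cross Virtual, 1), (Cap, 3)]" 3] by (simp add: eval_nat_numeral)
  also have "isotopic 3 3 \<dots> [(Cup, 2), (Cross Over, 1), (Cross Virtual, 1), (Cross Virtual, 3), (Cap, 3)]"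
    using isotopic_rewrite_back[OF disjI1[OF planar_isotopy.far[where i = 1 and j = 1 and p = "Cross Virtual" and q = "Cross Virtual", OF order_refl]], of 3 "[(Cup, 2), (Cross Over, 1)]" 5 5 "[(Cap, 3)]" 3] by (simp add: eval_nat_numeral)
  also have "isotopic 3 3 \<dots> [(Cup, 2), (Cross Over, 1), (Cross Virtual, 1), (Cap, 3)]"
    using isotopic_rewrite[OF disjI2[OF reidemeister.R1_cap[of Virtual 3]], of 3 "[(Cup, 2), (Cross Over, 1), (Cross Virtual, 1)]" 5 3 "[]" 3] by simp
  also have "isotopic 3 3 \<dots> [(Cup, 2), (Cross Over, 1), (Cap, 3), (Cross Virtual, 1)]"
    using isotopic_rewrite[OF disjI1[OF planar_isotopy.far[where i = 1 and j = 1 and p = "Cross Virtual" and q = "Cap", OF order_refl]], of 3 "[(Cup, 2), (Cross Over, 1)]" 5 3 "[]" 3] by (simp add: eval_nat_numeral)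
  also have "isotopic 3 3 \<dots> [(Cup, 2), (Cap, 3), (Cross Over, 1), (Cross Virtual, 1)]"
    using isotopic_rewrite[OF disjI1[OF planar_isotopy.far[where i = 1 and j = 1 and p = "Cross Over" and q = "Cap", OF order_refl]], of 3 "[(Cup, 2)]" 5 3 "[(Cross Virtual, 1)]" 3] by (simp add: eval_nat_numeral)
  also have "isotopic 3 3 \<dots> [(Cross Over, 1), (Cross Virtual, 1)]"
    using isotopic_rewrite[OF disjI1[OF planar_isotopy.zigzag_left[of 2]], of 3 "[]" 3 3 "[(Cross Over, 1), (Cross Virtual, 1)]" 3] by simp
  finally show ?thesis .
qed

text \<open>
  The remaining chord becomes a curl at the maximum and disappears; then the outgoing strand
  slides off the maximum.
\<close>

lemma isotopic_close_up_core:
  "isotopic 1 1 [(Cup, 0), (Cross Virtual, 0), (Cross Virtual, 1), (Cross Over, 1), (Cross Over, 0), (Cross Over, 1), (Cross Virtual, 1), (Cap, 1)] []"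
proof -
  have "isotopic 1 1 [(Cup, 0), (Cross Virtual, 0), (Cross Virtual, 1), (Cross Over, 1), (Cross Over, 0), (Cross Over, 1), (Cross Virtual, 1), (Cap, 1)] [(Cup, 0), (Cross Virtual, 0), (Cross Virtual, 1), (Cross Over, 1), (Cross Over, 0), (Cross Over, 1), (Cap, 1)]"
    using isotopic_rewrite[OF disjI2[OF reidemeister.R1_cap[of Virtual 1]], of 1 "[(Cup, 0), (Cross Virtual, 0), (Cross Virtual, 1), (Cross Over, 1), (Cross Over, 0), (Cross Over, 1)]" 3 1 "[]" 1] by simp
  also have "isotopic 1 1 \<dots> [(Cup, 0), (Cross Virtual, 0), (Cross Virtual, 1), (Cross Over, 1), (Cross Over, 0), (Cap, 1)]"
    using isotopic_rewrite[OF disjI2[OF reidemeister.R1_cap[of Over 1]], of 1 "[(Cup, 0), (Cross Virtual, 0), (Cross Virtual, 1), (Cross Over, 1), (Cross Over, 0)]" 3 1 "[]" 1] by simp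
  also have "isotopic 1 1 \<dots> [(Cup, 0), (Cross Virtual, 0), (Cross Virtual, 1), (Cross Over, 1), (Cross Under, 1), (Cap, 0)]"
    using isotopic_rewrite_back[OF disjI1[OF planar_isotopy.slide_cap[of Under 0]], of 1 "[(Cup, 0), (Cross Virtual, 0), (Cross Virtual, 1), (Cross Over, 1)]" 3 1 "[]" 1] by simp
  also have "isotopic 1 1 \<dots> [(Cup, 0), (Cross Virtual, 0), (Cross Virtual, 1), (Cap, 0)]"
    using isotopic_rewrite[OF disjI2[OF reidemeister.R2[of Over 1]], of 1 "[(Cup, 0), (Cross Virtual, 0), (Cross Virtual, 1)]" 3 3 "[(Cap, 0)]" 1] by simp
  also have "isotopic 1 1 \<dots> [(Cup, 0), (Cross Virtual, 0), (Cross Virtual, 0), (Cap, 1)]"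
    using isotopic_rewrite[OF disjI1[OF planar_isotopy.slide_cap[of Virtual 0]], of 1 "[(Cup, 0), (Cross Virtual, 0)]" 3 1 "[]" 1] by simp
  also have "isotopic 1 1 \<dots> [(Cup, 0), (Cap, 1)]"
    using isotopic_rewrite[OF disjI2[OF reidemeister.R2[of Virtual 0]], of 1 "[(Cup, 0)]" 3 3 "[(Cap, 1)]" 1] by simp
  also have "isotopic 1 1 \<dots> []"
    using isotopic_rewrite[OF disjI1[OF planar_isotopy.zigzag_left[of 0]], of 1 "[]" 1 1 "[]" 1] by simp
  finally show ?thesis .
qed

text \<open>
  A minimum to the right of the tangle \<open>X\<close> can be drawn above \<open>X\<close> instead of below.
\<close>

lemma isotopic_Cup_past:
  "tangle m X n \<Longrightarrow> isotopic (m + k) (n + k + 2) ((Cup, m) # X) (X @ [(Cup, n)])"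
proof (induction X arbitrary: m)
  case Nil
  then show ?case by (auto intro: isotopic.refl)
next
  case (Cons a X)
  obtain p i where a: "a = (p, i)" by fastforce
  define m' where "m' = m - ins p + outs p"
  have i: "i + ins p \<le> m" and X: "tangle m' X n"
    using Cons.prems unfolding a tangle.simps m'_def by blast+
  define j where "j = m - ins p"
  have m: "m = j + ins p" and m': "m' = j + outs p" and ij: "i \<le> j"
    using i by (auto simp: j_def m'_def)
  have X': "tangle (m' + k + 2) X (n + k + 2)"
    using tangle_add_strands[OF X, of "k + 2"] by (simp add: ac_simps)
  have 1: "isotopic (m + k) (n + k + 2) ([] @ [(Cup, m), (p, i)] @ X) ([] @ [(p, i), (Cup, m')] @ X)"
    unfolding m m'
    by (rule isotopic_rewrite_back[OF disjI1[OF planar_isotopy.far[OF ij, of p Cup]], where p = "m + k" and q = "m' + k + 2"])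
      (use ij X' in \<open>auto simp: m m' ac_simps\<close>)
  have 2: "isotopic (m + k) (n + k + 2) ([(p, i)] @ ((Cup, m') # X) @ []) ([(p, i)] @ (X @ [(Cup, n)]) @ [])"
    by (rule isotopic.in_context[OF _ Cons.IH[OF X]]) (use ij m m' in auto)
  show ?case using isotopic.trans 1 2 by (fastforce simp: a)
qed

definition braid :: "(kind \<times> nat) list \<Rightarrow> word" where
  "braid b = map (\<lambda>(k, i). (Cross k, i)) b"

definition braid_inverse :: "(kind \<times> nat) list \<Rightarrow> word" where
  "braid_inverse b = rev (map (\<lambda>(k, i). (Cross (opp k), i)) b)"

lemma tangle_braid: "\<forall>(k, i) \<in> set b. i + 2 \<le> m \<Longrightarrow> tangle m (braid b) m"
proof (induction b)
  case (Cons a b)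
  obtain k i where "a = (k, i)" by fastforce
  moreover from this have "m - 2 + 2 = m" using Cons.prems by auto
  ultimately show ?case using Cons unfolding braid_def by (simp del: add_2_eq_Suc')
qed (simp add: braid_def)

lemma isotopic_braid_inverse:
  "\<forall>(k, i) \<in> set b. i + 2 \<le> m \<Longrightarrow> isotopic m m (braid b @ braid_inverse b) []"
proof (induction b)
  case (Cons a b)
  obtain k i where a: "a = (k, i)" by fastforce
  have i: "i + 2 \<le> m" using Cons.prems a by simp
  have "isotopic m m ([(Cross k, i)] @ (braid b @ braid_inverse b) @ [(Cross (opp k), i)])
      ([(Cross k, i)] @ [] @ [(Cross (opp k), i)])"
    by (rule isotopic.in_context[OF _ Cons.IH]) (use i Cons.prems in auto)
  also have "isotopic m m \<dots> []" using isotopic_R2[OF i] by simp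
  finally show ?case by (simp add: a braid_def braid_inverse_def)
qed (auto simp: braid_def braid_inverse_def intro: isotopic.refl)

section \<open>The family of long knots\<close>

abbreviation virt :: "nat \<Rightarrow> piece \<times> nat" where "virt i \<equiv> (Cross Virtual, i)"
abbreviation over :: "nat \<Rightarrow> piece \<times> nat" where "over i \<equiv> (Cross Over, i)"
abbreviation under :: "nat \<Rightarrow> piece \<times> nat" where "under i \<equiv> (Cross Under, i)"

text \<open>
  A chord in which the second of four strands passes over the fourth one.
\<close>

definition core :: word where "core = [virt 2, over 1, virt 1, virt 2]"

text \<open>
  These words act on six strands.  The legs of a minimum are at positions \<open>3\<close> and \<open>4\<close>, and the strand
  at position \<open>5\<close> sweeps: it crosses both legs virtually to the left and returns below them.  The
  clasp is a double chord in which the leg at position \<open>4\<close> passes twice over the other one, both times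
  with the same sign; hence one flip makes the two chords cancel.
\<close>

definition sweep :: word where "sweep = [virt 4, virt 3, under 3, under 4]"
definition clasp :: word where "clasp = [virt 3, over 3, virt 3, over 3]"
definition unsweep :: word where "unsweep = [over 4, over 3, virt 3, virt 4]"

text \<open>
  The third strand of \<open>B\<close> leaves at the top, returns to the bottom on the right of \<open>B\<close> and continues
  as the fourth strand, which finally takes the third position.  A gate does the same, and above \<open>B\<close>
  the fourth strand of \<open>B\<close> and the returning strand are the two legs that are swept and clasped.
\<close>

definition join :: "word \<Rightarrow> word" where
  "join B = (Cup, 3) # B @ [virt 2, (Cap, 3)]"

definition gate :: "word \<Rightarrow> word" where
  "gate B = (Cup, 3) # B @ sweep @ clasp @ unsweep @ [virt 2, (Cap, 3)]"

text \<open>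
  A strand enters at position \<open>0\<close>, is pushed to position \<open>2\<close> by the new minimum, goes up through \<open>X\<close>
  as its third strand, comes back through \<open>X\<close> as its second strand, and leaves at position \<open>0\<close>.
  Before it leaves it passes below the incoming and the returning strand.  These two chords cancel
  when \<open>X\<close> is trivial, and they serve to restore the colour with which the strand entered.
\<close>

definition close_up :: "word \<Rightarrow> word" where
  "close_up X = [(Cup, 0), virt 0, virt 1, over 1, over 0] @ X @ [(Cap, 1)]"

definition gates :: "nat \<Rightarrow> word \<Rightarrow> word" where
  "gates n = gate ^^ n"

lemmas word_defs = sweep_def clasp_def unsweep_def

lemma tangle_strands_5_6: "tangle 4 B 4 \<Longrightarrow> tangle 6 B 6" "tangle 4 B 4 \<Longrightarrow> tangle 5 B 5"
  using tangle_add_strands[of 4 B 4 2] tangle_add_strands[of 4 B 4 1] by simp_all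

lemma tangle_core: "tangle 4 core 4"
  by (simp add: core_def)

lemma tangle_join:
  assumes "tangle 4 B 4"
  shows "tangle 3 (join B) 3" "tangle 4 (join B) 4"
proof -
  show "tangle 3 (join B) 3"
    using tangle_strands_5_6[OF assms] by (auto simp: join_def intro!: tangle_appendI[of _ B])
  then show "tangle 4 (join B) 4" using tangle_add_strands[of 3 _ 3 1] by simp
qed

lemma tangle_gate:
  assumes "tangle 4 B 4"
  shows "tangle 4 (gate B) 4"
  using tangle_strands_5_6[OF assms] by (auto simp: gate_def word_defs intro!: tangle_appendI[of _ B])

lemma tangle_gates: "tangle 4 B 4 \<Longrightarrow> tangle 4 (gates n B) 4"
  by (induction n) (auto simp: gates_def tangle_gate)

lemma tangle_close_up: "tangle 3 X 3 \<Longrightarrow> tangle 1 (close_up X) 1"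
  by (auto simp: close_up_def eval_nat_numeral intro!: tangle_appendI[of _ X])

lemma isotopic_add_strands: "isotopic m n x y \<Longrightarrow> isotopic (m + k) (n + k) x y"
proof (induction rule: isotopic.induct)
  case (in_context m u p q x y v n)
  then show ?case by (meson tangle_add_strands isotopic.in_context)
qed (auto intro: isotopic.intros tangle_add_strands)

lemma isotopic_gate:
  assumes "isotopic 4 4 B B'"
  shows "isotopic 4 4 (gate B) (gate B')"
proof -
  have "isotopic 6 6 B B'" using isotopic_add_strands[OF assms, of 2] by simp
  then have "isotopic 4 4 ([(Cup, 3)] @ B @ (sweep @ clasp @ unsweep @ [virt 2, (Cap, 3)]))
      ([(Cup, 3)] @ B' @ (sweep @ clasp @ unsweep @ [virt 2, (Cap, 3)]))"
    by (rule isotopic.in_context[rotated]) (simp_all add: word_defs)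
  then show ?thesis by (simp add: gate_def)
qed

lemma isotopic_gates: "isotopic 4 4 B B' \<Longrightarrow> isotopic 4 4 (gates n B) (gates n B')"
  by (induction n) (auto simp: gates_def isotopic_gate)

lemma isotopic_join:
  assumes "isotopic 4 4 B B'"
  shows "isotopic 3 3 (join B) (join B')"
proof -
  have "isotopic 5 5 B B'" using isotopic_add_strands[OF assms, of 1] by simp
  then have "isotopic 3 3 ([(Cup, 3)] @ B @ [virt 2, (Cap, 3)]) ([(Cup, 3)] @ B' @ [virt 2, (Cap, 3)])"
    by (rule isotopic.in_context[rotated]) simp_all
  then show ?thesis by (simp add: join_def)
qed

lemma isotopic_close_up:
  assumes "isotopic 3 3 X X'"
  shows "isotopic 1 1 (close_up X) (close_up X')"
  unfolding close_up_def by (rule isotopic.in_context[OF _ assms]) simp_all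

text \<open>
  A tangle on three strands is a tangle on four strands whose last strand is straight.  Then the
  return path of the third strand is a zigzag with a virtual curl.
\<close>

lemma isotopic_join_passive:
  assumes X: "tangle 3 X 3"
  shows "isotopic 3 3 (join X) X"
proof -
  have "isotopic 3 3 ([] @ ((Cup, 3) # X) @ [virt 2, (Cap, 3)]) ([] @ (X @ [(Cup, 3)]) @ [virt 2, (Cap, 3)])"
    by (rule isotopic.in_context[of _ _ 3 5]) (use isotopic_Cup_past[OF X, of 0] in auto)
  then have "isotopic 3 3 (join X) (X @ [(Cup, 3), virt 2, (Cap, 3)])"
    by (simp add: join_def)
  also have "isotopic 3 3 (X @ [(Cup, 3), virt 2, (Cap, 3)]) X"
    using isotopic_append[OF isotopic.refl[OF X] isotopic_straighten] by simp
  finally show ?thesis .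
qed

text \<open>
  The minimum and its legs share no crossing with \<open>X\<close> and can be lifted above \<open>X\<close>.  Then nothing
  separates the minimum from the sweep: the sweeping strand slides off, the clasp untwists, and the second sweep slides off as well.
\<close>

lemma isotopic_gate_passive:
  assumes X: "tangle 3 X 3"
  shows "isotopic 4 4 (gate X) X"
proof -
  have X4: "tangle 4 X 4" using tangle_add_strands[OF X, of 1] by simp
  let ?end = "[virt 2, (Cap, 3)]"
  have tail: "tangle 6 (clasp @ unsweep @ ?end) 4" "tangle 6 (unsweep @ ?end) 4" "tangle 6 ?end 4"
    by (simp_all add: word_defs)
  note past = isotopic_append[OF isotopic.refl[OF X4]]
  have "isotopic 4 4 ([] @ ((Cup, 3) # X) @ (sweep @ clasp @ unsweep @ ?end))
      ([] @ (X @ [(Cup, 3)]) @ (sweep @ clasp @ unsweep @ ?end))"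
    by (rule isotopic.in_context[of _ _ 4 6]) (use isotopic_Cup_past[OF X, of 1] in \<open>auto simp: word_defs\<close>)
  then have "isotopic 4 4 (gate X) (X @ (Cup, 3) # sweep @ clasp @ unsweep @ ?end)"
    by (simp add: gate_def)
  also have "isotopic 4 4 \<dots> (X @ (Cup, 3) # clasp @ unsweep @ ?end)"
    using past[OF isotopic_append[OF _ isotopic.refl[OF tail(1)], of 4 "(Cup, 3) # sweep" "[(Cup, 3)]"]]
      isotopic_Cup_sweep by (simp add: sweep_def)
  also have "isotopic 4 4 \<dots> (X @ (Cup, 3) # unsweep @ ?end)"
    using past[OF isotopic_append[OF _ isotopic.refl[OF tail(2)], of 4 "(Cup, 3) # clasp" "[(Cup, 3)]"]]
      isotopic_Cup_clasp by (simp add: clasp_def)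
  also have "isotopic 4 4 \<dots> (X @ (Cup, 3) # ?end)"
    using past[OF isotopic_append[OF _ isotopic.refl[OF tail(3)], of 4 "(Cup, 3) # unsweep" "[(Cup, 3)]"]]
      isotopic_Cup_unsweep by (simp add: unsweep_def)
  also have "isotopic 4 4 \<dots> X"
    using past[OF isotopic_add_strands[OF isotopic_straighten, of 1, simplified]] by simp
  finally show ?thesis .
qed

lemma isotopic_gates_passive: "tangle 3 X 3 \<Longrightarrow> isotopic 4 4 (gates n X) X"
proof (induction n)
  case 0
  then show ?case using tangle_add_strands[of 3 X 3 1] by (auto simp: gates_def intro: isotopic.refl)
next
  case (Suc n)
  then show ?case using isotopic_gate isotopic_gate_passive by (auto simp: gates_def intro: isotopic.trans)
qed

text \<open>
  The last crossing of the clasp is changed.  The letters before it, from the beginning of the sweep,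
  are then followed by their inverses in reversed order.
\<close>

lemma flip_gate:
  assumes B: "tangle 4 B 4"
  shows "\<exists>B'. flip 4 4 (gate B) B' \<and> isotopic 4 4 B' (join B)"
proof -
  define b :: "(kind \<times> nat) list" where "b = [(Virtual, 4), (Virtual, 3), (Under, 3), (Under, 4), (Virtual, 3), (Over, 3), (Virtual, 3)]"
  let ?u = "(Cup, 3) # B @ braid b" and ?v = "unsweep @ [virt 2, (Cap, 3)]"
  let ?B' = "?u @ [virt 3, under 3, virt 3] @ ?v"
  have B6: "tangle 4 ((Cup, 3) # B) 6" using tangle_strands_5_6[OF B] by simp
  have "gate B = ?u @ [over 3] @ ?v"
    by (simp add: gate_def sweep_def clasp_def b_def braid_def)
  moreover have "tangle 4 ?u 6"
    using tangle_appendI[OF B6 tangle_braid[of b 6]] by (simp add: b_def)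
  ultimately have "flip 4 4 (gate B) ?B'"
    unfolding flip_def
    by (intro exI[of _ ?u] exI[of _ ?v] exI[of _ Over] exI[of _ 3] exI[of _ 6]) (simp add: unsweep_def)
  moreover have "isotopic 4 4 (((Cup, 3) # B) @ (braid b @ braid_inverse b) @ [virt 2, (Cap, 3)])
      (((Cup, 3) # B) @ [] @ [virt 2, (Cap, 3)])"
    by (rule isotopic.in_context[OF B6 isotopic_braid_inverse]) (simp_all add: b_def)
  then have "isotopic 4 4 ?B' (join B)"
    by (simp add: join_def b_def braid_inverse_def unsweep_def)
  ultimately show ?thesis by blast
qed

lemma flip_add_strands:
  assumes "flip m n x y"
  shows "flip (m + j) (n + j) x y"
proof -
  from assms obtain u v k i p where "x = u @ [(Cross k, i)] @ v"
    "y = u @ [virt i, (Cross (opp k), i), virt i] @ v"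
    "tangle m u p" "i + 3 \<le> p" "tangle p v n"
    unfolding flip_def by blast
  then show ?thesis
    using tangle_add_strands[of m u p j] tangle_add_strands[of p v n j] unfolding flip_def
    by (intro exI[of _ u] exI[of _ v] exI[of _ k] exI[of _ i] exI[of _ "p + j"]) simp
qed

lemma flip_gates:
  assumes "flip 4 4 B B'"
  shows "flip 4 4 (gates n B) (gates n B')"
proof (induction n)
  case (Suc n)
  let ?v = "sweep @ clasp @ unsweep @ [virt 2, (Cap, 3)]"
  have "flip 4 4 ([(Cup, 3)] @ gates n B @ ?v) ([(Cup, 3)] @ gates n B' @ ?v)"
    by (rule flip_in_context[OF _ flip_add_strands[OF Suc, of 2, simplified]]) (simp_all add: word_defs)
  then show ?case by (simp add: gates_def gate_def)
qed (use assms in \<open>simp add: gates_def\<close>)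

definition long_chain :: "nat \<Rightarrow> word" where
  "long_chain n = close_up (join (gates n core))"

text \<open>
  The gate with number \<open>j + 1\<close>, counted from the inside, is opened; the \<open>m\<close> gates around it then find
  a straight last strand and dissolve.
\<close>

lemma flip_long_chain:
  assumes "j < n"
  shows "\<exists>w. flip 1 1 (long_chain n) w \<and> isotopic 1 1 w (long_chain j)"
proof -
  obtain m where n: "n = m + Suc j" using assms by (metis add.commute less_natE plus_1_eq_Suc add_Suc_right)
  let ?B = "gates j core"
  have B: "tangle 4 ?B 4" by (intro tangle_gates tangle_core)
  have n': "gates n core = gates m (gate ?B)"
    by (simp add: n gates_def funpow_add funpow_swap1)
  obtain B' where B': "flip 4 4 (gate ?B) B'" "isotopic 4 4 B' (join ?B)"
    using flip_gate[OF B] by blast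
  have "flip 5 5 (gates m (gate ?B)) (gates m B')"
    using flip_add_strands[OF flip_gates[OF B'(1)], of 1] by simp
  then have "flip 3 3 ([(Cup, 3)] @ gates m (gate ?B) @ [virt 2, (Cap, 3)])
      ([(Cup, 3)] @ gates m B' @ [virt 2, (Cap, 3)])"
    by (rule flip_in_context[rotated]) simp_all
  then have "flip 3 3 (join (gates n core)) (join (gates m B'))"
    by (simp add: join_def n')
  then have "flip 1 1 (long_chain n) (close_up (join (gates m B')))"
    unfolding long_chain_def close_up_def by (rule flip_in_context[rotated]) simp_all
  moreover have "isotopic 3 3 (join (gates m B')) (join ?B)"
  proof -
    have "isotopic 4 4 (gates m B') (gates m (join ?B))" using B'(2) by (rule isotopic_gates)
    also have "isotopic 4 4 \<dots> (join ?B)" by (intro isotopic_gates_passive tangle_join B)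
    finally have "isotopic 3 3 (join (gates m B')) (join (join ?B))" by (rule isotopic_join)
    also have "isotopic 3 3 \<dots> (join ?B)" by (intro isotopic_join_passive tangle_join B)
    finally show ?thesis .
  qed
  then have "isotopic 1 1 (close_up (join (gates m B'))) (long_chain j)"
    unfolding long_chain_def by (rule isotopic_close_up)
  ultimately show ?thesis by blast
qed

lemma isotopic_long_chain_0: "isotopic 1 1 (long_chain 0) []"
proof -
  have "isotopic 1 1 (long_chain 0) (close_up [over 1, virt 1])"
    unfolding long_chain_def gates_def
    by (rule isotopic_close_up) (use isotopic_join_core in \<open>simp add: join_def core_def\<close>)
  also have "isotopic 1 1 \<dots> []" using isotopic_close_up_core by (simp add: close_up_def)
  finally show ?thesis .
qed

section \<open>Orientations\<close>

context symmetric_quandle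
begin

fun reach :: "word \<Rightarrow> 'c list \<Rightarrow> 'c list \<Rightarrow> bool" where
  "reach [] s s' \<longleftrightarrow> s = s'"
| "reach ((p, i) # w) s s' \<longleftrightarrow> (\<exists>t \<in> step p i s. reach w t s')"

lemma reach_append: "reach (u @ v) s s' \<longleftrightarrow> (\<exists>t. reach u s t \<and> reach v t s')"
proof (induction u arbitrary: s)
  case (Cons a u)
  then show ?case by (cases a) (simp, blast)
qed simp

lemma finite_left_step: "finite (left_step p s)"
  by (induction p s rule: left_step.induct) (auto simp: finite_C)

lemma finite_step: "finite (step p i s)"
  by (induction p i s rule: step.induct) (auto simp: step.simps finite_left_step)

lemma ev_pos: "reach w s s' \<Longrightarrow> \<phi> s' > 0 \<Longrightarrow> ev w \<phi> s > 0"
proof (induction w arbitrary: s)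
  case (Cons a w)
  obtain p i where a: "a = (p, i)" by fastforce
  with Cons obtain t where t: "t \<in> step p i s" "ev w \<phi> t > 0" by auto
  have "ev w \<phi> t \<le> (\<Sum>s' \<in> step p i s. ev w \<phi> s')"
    by (rule member_le_sum) (use t finite_step in auto)
  then show ?case using t a by simp
qed simp

end

text \<open>
  Colourings by this quandle are the orientations of the curve: the colour tells whether the strand
  runs upwards, which changes at minima and maxima.
\<close>

interpretation ori: symmetric_quandle "UNIV :: bool set" Not "\<lambda>_ b. b"
  by unfold_locales auto

lemma ori_cross [simp]: "ori.cross k x y = [y, x]"
  by (cases k) auto

lemma ori_step_Not: "t \<in> ori.step p i s \<Longrightarrow> map Not t \<in> ori.step p i (map Not s)"
proof (induction p i s arbitrary: t rule: ori.step.induct)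
  case (1 p s)
  then show ?case
    by (cases "(p, s)" rule: ori.left_step.cases) (auto simp: ori.step.simps split: if_splits)
qed (auto simp: ori.step.simps)

lemma ori_reach_Not: "ori.reach w s s' \<Longrightarrow> ori.reach w (map Not s) (map Not s')"
proof (induction w arbitrary: s)
  case (Cons a w)
  obtain p i where a: "a = (p, i)" by fastforce
  with Cons obtain t where "t \<in> ori.step p i s" "ori.reach w t s'" by auto
  then show ?case using Cons.IH ori_step_Not a by (metis ori.reach.simps(2))
qed simp

text \<open>
  The ends of a tangle without lower ends are matched in pairs by the arcs of the tangle.  A matching
  is described by a list of labels; the two ends of an arc carry the same label with opposite truth
  values.  A valuation of the labels chooses an orientation of every arc.
\<close>

definition paired :: "(nat \<times> bool) list \<Rightarrow> bool" where
  "paired ps \<longleftrightarrow> distinct ps \<and> (\<forall>l b. (l, b) \<in> set ps \<longrightarrow> (l, \<not> b) \<in> set ps)"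

abbreviation orient :: "(nat \<Rightarrow> bool) \<Rightarrow> (nat \<times> bool) list \<Rightarrow> bool list" where
  "orient v \<equiv> map (\<lambda>(l, b). v l = b)"

text \<open>
  Pieces are added at the top.  A minimum introduces an arc with a fresh label.  A maximum either
  closes an arc, which is consistent because its ends have opposite values, or connects two arcs:
  then the free end of the second one inherits the label and value of the connected end of the first
  one, and the orientation of the second arc is determined by that of the first.
\<close>

lemma paired_step:
  assumes "paired ps" "i + ins p \<le> length ps"
  shows "\<exists>ps'. paired ps' \<and> length ps' = length ps - ins p + outs p \<and>
    (\<forall>v'. \<exists>v. orient v' ps' \<in> ori.step p i (orient v ps))"
proof -
  define l h t where "l = take i ps" and "h = take (ins p) (drop i ps)" and "t = drop (ins p) (drop i ps)"
  have ps: "ps = l @ h @ t" and l: "length l = i" and h: "length h = ins p"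
    using assms(2) by (simp_all add: l_def h_def t_def del: drop_drop)
  have step: "ori.step p i (orient v ps) = (@) (orient v l) ` ori.left_step p (orient v h @ orient v t)" for v
    using ori.step_prefix[of p "orient v l" 0 "orient v (h @ t)"] l ps by (simp add: ori.step.simps)
  show ?thesis
  proof (cases p)
    case Cup
    obtain m where m: "m \<notin> fst ` set ps"
      using ex_new_if_finite[of "fst ` set ps"] by auto
    let ?ps = "l @ (m, True) # (m, False) # t"
    have h: "h = []" using h Cup by simp
    have fresh: "(m, c) \<notin> set ps" for c using m by force
    have set_ps: "set ?ps = insert (m, True) (insert (m, False) (set ps))" using ps h by auto
    have "paired ?ps"
      unfolding paired_def
    proof (intro conjI allI impI)
      show "distinct ?ps" using assms(1) fresh unfolding paired_def ps h by simp
      fix x c assume "(x, c) \<in> set ?ps"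
      then consider "x = m" | "(x, c) \<in> set ps" unfolding set_ps by blast
      then show "(x, \<not> c) \<in> set ?ps"
      proof cases
        case 1
        then show ?thesis unfolding set_ps by (cases c) simp_all
      next
        case 2
        then show ?thesis using assms(1) unfolding set_ps paired_def by blast
      qed
    qed
    moreover have "orient v ?ps \<in> ori.step p i (orient v ps)" for v
      unfolding step using Cup h by auto
    ultimately show ?thesis using Cup ps h by (intro exI[of _ ?ps]) auto
  next
    case (Cross k)
    then obtain a b where h: "h = [a, b]" using h by (auto simp: numeral_2_eq_2 length_Suc_conv)
    let ?ps = "l @ b # a # t"
    have "set ?ps = set ps" "distinct ?ps = distinct ps" by (auto simp add: ps h)
    then have "paired ?ps"
      using assms(1) unfolding paired_def by simp
    moreover have "orient v ?ps \<in> ori.step p i (orient v ps)" for v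
      unfolding step using Cross h by (cases a; cases b) auto
    ultimately show ?thesis using Cross ps h by (intro exI[of _ ?ps]) auto
  next
    case Cap
    then obtain l1 b1 l2 b2 where h: "h = [(l1, b1), (l2, b2)]"
      using h by (auto simp: numeral_2_eq_2 length_Suc_conv)
    have d: "distinct (l @ h @ t)" using assms(1) unfolding paired_def ps by blast
    have dist: "distinct (l @ t)" and notin: "(l1, b1) \<notin> set (l @ t)" "(l2, b2) \<notin> set (l @ t)"
      using d unfolding h by auto
    have closed: "(x, \<not> c) \<in> insert (l1, b1) (insert (l2, b2) (set (l @ t)))"
      if "(x, c) \<in> insert (l1, b1) (insert (l2, b2) (set (l @ t)))" for x c
    proof -
      have set_ps: "insert (l1, b1) (insert (l2, b2) (set (l @ t))) = set ps"
        unfolding ps h by simp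
      show ?thesis using assms(1) that unfolding set_ps paired_def by blast
    qed
    have ne: "(l1, b1) \<noteq> (l2, b2)" using d unfolding h by simp
    show ?thesis
    proof (cases "l1 = l2")
      case True
      then have b2: "b2 = (\<not> b1)" using ne by auto
      have "paired (l @ t)"
        unfolding paired_def
      proof (intro conjI allI impI dist)
        fix x c assume xc: "(x, c) \<in> set (l @ t)"
        then have "(x, \<not> c) \<in> insert (l1, b1) (insert (l2, b2) (set (l @ t)))" using closed by blast
        moreover have "(x, \<not> c) \<noteq> (l1, b1)" "(x, \<not> c) \<noteq> (l2, b2)"
          using xc notin True b2 by (cases c; cases b1; auto)+
        ultimately show "(x, \<not> c) \<in> set (l @ t)" by blast
      qed
      moreover have "orient v (l @ t) \<in> ori.step p i (orient v ps)" for v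
        unfolding step using Cap h True b2 by auto
      ultimately show ?thesis using Cap ps h by (intro exI[of _ "l @ t"]) auto
    next
      case False
      define g where "g e = (if e = (l2, \<not> b2) then (l1, b1) else e)" for e
      let ?ps = "map g (l @ t)"
      have inj: "inj_on g (set (l @ t))"
        using notin by (auto simp: inj_on_def g_def)
      have set_ps: "set ?ps = g ` set (l @ t)" by (simp add: image_Un)
      have "paired ?ps"
        unfolding paired_def
      proof (intro conjI allI impI)
        show "distinct ?ps" using dist inj by (simp only: distinct_map)
        have other: "(l1, \<not> b1) \<in> set (l @ t)" "(l2, \<not> b2) \<in> set (l @ t)"
          using closed[of l1 b1] closed[of l2 b2] False by auto
        fix x c assume "(x, c) \<in> set ?ps"
        then obtain e where e: "e \<in> set (l @ t)" "(x, c) = g e" unfolding set_ps by blast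
        show "(x, \<not> c) \<in> set ?ps"
        proof (cases "e = (l2, \<not> b2)")
          case True
          then have "(x, \<not> c) = g (l1, \<not> b1)" using e(2) False by (simp add: g_def)
          then show ?thesis using other(1) unfolding set_ps by blast
        next
          case ne: False
          then have xc: "(x, c) \<in> set (l @ t)" "(x, c) \<noteq> (l2, \<not> b2)" using e by (auto simp: g_def)
          then have "(x, \<not> c) \<in> insert (l1, b1) (insert (l2, b2) (set (l @ t)))" using closed by blast
          moreover have "(x, \<not> c) \<noteq> (l2, b2)" using xc by auto
          ultimately consider "(x, \<not> c) = (l1, b1)" | "(x, \<not> c) \<in> set (l @ t)" by blast
          then show ?thesis
          proof cases
            case 1
            then have "(x, \<not> c) = g (l2, \<not> b2)" by (simp add: g_def)
            then show ?thesis using other(2) unfolding set_ps by blast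
          next
            case 2
            have "(x, \<not> c) \<noteq> (l2, \<not> b2)" using xc notin by auto
            then have "(x, \<not> c) = g (x, \<not> c)" by (metis g_def)
            then show ?thesis using 2 unfolding set_ps by blast
          qed
        qed
      qed
      moreover have "\<exists>v. orient v' ?ps \<in> ori.step p i (orient v ps)" for v'
      proof -
        define v where "v = v'(l2 := ((v' l1 = b1) = (\<not> b2)))"
        have "(case e of (x, c) \<Rightarrow> v x = c) = (case g e of (x, c) \<Rightarrow> v' x = c)" if "e \<in> set (l @ t)" for e
        proof -
          obtain x c where e: "e = (x, c)" by fastforce
          show ?thesis
          proof (cases "x = l2")
            case True
            then have "c \<noteq> b2" using that notin(2) e by blast
            then have "c = (\<not> b2)" by blast
            then have "g e = (l1, b1)" "(v x = c) = (v' l1 = b1)" using e True by (auto simp: g_def v_def)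
            then show ?thesis using e by simp
          next
            case False
            then show ?thesis using e by (simp add: g_def v_def)
          qed
        qed
        then have "orient v' ?ps = orient v (l @ t)" by (simp only: map_map comp_def cong: map_cong)
        moreover have "(v l2 = b2) = (\<not> (v l1 = b1))"
          using False by (auto simp: v_def)
        then have "orient v (l @ t) \<in> ori.step p i (orient v ps)"
          unfolding step using Cap h by auto
        ultimately show ?thesis by metis
      qed
      ultimately show ?thesis using Cap ps h by (intro exI[of _ ?ps]) auto
    qed
  qed
qed

lemma orientable:
  "tangle 0 w n \<Longrightarrow> \<exists>ps. paired ps \<and> length ps = n \<and> (\<forall>v. ori.reach w [] (orient v ps))"
proof (induction w arbitrary: n rule: rev_induct)
  case Nil
  then show ?case by (intro exI[of _ "[]"]) (auto simp: paired_def)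
next
  case (snoc a w)
  obtain p i where a: "a = (p, i)" by fastforce
  obtain m where m: "tangle 0 w m" "i + ins p \<le> m" "n = m - ins p + outs p"
    using snoc.prems unfolding a by (auto simp only: tangle_append tangle.simps)
  obtain ps where ps: "paired ps" "length ps = m" "\<And>v. ori.reach w [] (orient v ps)"
    using snoc.IH[OF m(1)] by blast
  obtain ps' where ps': "paired ps'" "length ps' = n"
    "\<And>v'. \<exists>v. orient v' ps' \<in> ori.step p i (orient v ps)"
    using paired_step[of ps i p] ps m by auto
  have "ori.reach (w @ [a]) [] (orient v' ps')" for v'
    using ps'(3)[of v'] ps(3) by (auto simp: a ori.reach_append)
  then show ?case using ps' by blast
qed

text \<open>
  The orientation of the minimum at the beginning can be prescribed, because an orientation may be
  reversed.
\<close>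

lemma closed_orientable:
  assumes "tangle 0 ((Cup, 0) # w) 0"
  shows "ori.reach w [True, False] []"
proof -
  obtain ps where "length ps = 0" "\<And>v. ori.reach ((Cup, 0) # w) [] (orient v ps)"
    using orientable[OF assms] by blast
  then obtain x where x: "ori.reach w [x, \<not> x] []" by (auto simp: ori.step.simps)
  show ?thesis
  proof (cases x)
    case False
    then show ?thesis using ori_reach_Not[OF x] by simp
  qed (use x in simp)
qed

section \<open>Colourings by integers modulo an odd number\<close>

text \<open>
  Here \<open>h\<close> represents one half modulo the odd number \<open>N\<close>.  A colour consists of a residue and a
  direction, \<open>True\<close> for upwards.  Two multipliers inverse to each other, \<open>h\<close> and \<open>2\<close>, belong to the two
  directions of the upper strand.  The value \<open>2\<close> is special: it allows the two additional chords of
  \<open>close_up\<close> to restore the colour, and it makes the gates invisible in one of the two orientations.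
\<close>

locale affine =
  fixes N h :: int
  assumes N: "N > 1" and half: "N dvd 2 * h - 1"
begin

definition pass_under :: "bool \<Rightarrow> int \<Rightarrow> int \<Rightarrow> int" where
  "pass_under up y b = ((if up then h else 2) * b + (1 - (if up then h else 2)) * y) mod N"

definition R :: "int set" where "R = {0..<N}"

abbreviation C :: "(int \<times> bool) set" where "C \<equiv> R \<times> UNIV"

fun bar :: "int \<times> bool \<Rightarrow> int \<times> bool" where "bar (z, b) = (z, \<not> b)"
fun act :: "int \<times> bool \<Rightarrow> int \<times> bool \<Rightarrow> int \<times> bool" where
  "act (y, b) (z, c) = (pass_under b y z, c)"

lemma pass_under_in_R [simp]: "pass_under b y z \<in> R"
  using N by (simp add: pass_under_def R_def)

lemma R_eqI: "x \<in> R \<Longrightarrow> y \<in> R \<Longrightarrow> N dvd x - y \<Longrightarrow> x = y"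
  by (metis R_def atLeastLessThan_iff mod_eq_dvd_iff mod_pos_pos_trivial)

lemma pass_under_False: "\<exists>k. pass_under False y z = 2 * z - y + N * k"
proof -
  have "pass_under False y z = (2 * z - y) mod N" by (simp add: pass_under_def)
  then show ?thesis by (metis minus_mult_div_eq_mod diff_conv_add_uminus mult_minus_right)
qed

lemma pass_under_True: "\<exists>k. 2 * pass_under True y z = z + y + N * k"
proof -
  obtain c where c: "2 * h - 1 = N * c" using half by blast
  have "pass_under True y z = (h * z + (1 - h) * y) mod N" by (simp add: pass_under_def)
  then have "pass_under True y z = h * z + (1 - h) * y - N * ((h * z + (1 - h) * y) div N)"
    by (simp add: minus_mult_div_eq_mod)
  then have "2 * pass_under True y z = z + y + (2 * h - 1) * (z - y) - 2 * N * ((h * z + (1 - h) * y) div N)"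
    by (simp add: algebra_simps)
  also have "\<dots> = z + y + N * (c * (z - y) - 2 * ((h * z + (1 - h) * y) div N))"
    unfolding c by (simp add: algebra_simps)
  finally show ?thesis by blast
qed

lemma dvd_double: "N dvd 2 * a \<Longrightarrow> N dvd a"
proof -
  assume "N dvd 2 * a"
  then have "N dvd h * (2 * a) - (2 * h - 1) * a" by (rule dvd_diff[OF dvd_mult dvd_mult2[OF half]])
  then show ?thesis by (simp add: algebra_simps)
qed

lemma dvd_power_2: "N dvd 2 ^ n * a \<Longrightarrow> N dvd a"
proof (induction n)
  case (Suc n)
  then show ?case using dvd_double[of "2 ^ n * a"] by (simp add: ac_simps)
qed simp

lemma pass_under_cancel: "z \<in> R \<Longrightarrow> pass_under (\<not> b) y (pass_under b y z) = z"
proof (rule R_eqI)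
  obtain k where k: "pass_under False y (pass_under True y z) = 2 * pass_under True y z - y + N * k" using pass_under_False by blast
  obtain l where l: "2 * pass_under True y z = z + y + N * l" using pass_under_True by blast
  obtain m where m: "2 * pass_under True y (pass_under False y z) = pass_under False y z + y + N * m" using pass_under_True by blast
  obtain n where n: "pass_under False y z = 2 * z - y + N * n" using pass_under_False by blast
  show "N dvd pass_under (\<not> b) y (pass_under b y z) - z"
  proof (cases b)
    case True
    then have "pass_under (\<not> b) y (pass_under b y z) - z = N * (k + l)" using k l by (simp add: algebra_simps)
    then show ?thesis by simp
  next
    case False
    define e where "e = pass_under True y (pass_under False y z)"
    have "2 * (e - z) = N * (m + n)" using m n unfolding e_def[symmetric] by (simp add: algebra_simps)
    then have "N dvd e - z" by (metis dvd_double dvd_triv_left)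
    then show ?thesis using False by (simp add: e_def)
  qed
qed auto

lemma pass_under_mv: "pass_under a x (pass_under b y z) = pass_under b (pass_under a x y) (pass_under a x z)"
proof -
  define s r where "s = (if a then h else 2)" and "r = (if b then h else 2)"
  have lin: "(c * (X mod N) + d * (Y mod N)) mod N = (c * X + d * Y) mod N" for c d X Y
    by (metis mod_add_eq mod_mult_right_eq)
  have lin': "(c * (X mod N) + d) mod N = (c * X + d) mod N" for c d X
    by (metis mod_add_left_eq mod_mult_right_eq)
  show ?thesis
    unfolding pass_under_def s_def[symmetric] r_def[symmetric] lin unfolding lin'
    by (rule arg_cong[where f = "\<lambda>e. e mod N"]) (simp add: algebra_simps)
qed

sublocale symmetric_quandle C bar act
proof
  show "finite C" by (simp add: R_def)
next
  fix x assume "x \<in> C"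
  then show "bar x \<in> C" "bar (bar x) = x" by (cases x; simp)+
next
  fix x b assume "x \<in> C" "b \<in> C"
  then show "act x b \<in> C" "act (bar x) (act x b) = b" "bar (act x b) = act x (bar b)"
    by (cases x; cases b; simp add: pass_under_cancel)+
next
  fix x assume "x \<in> C"
  then show "act x x = x"
    by (cases x) (auto simp: pass_under_def R_def algebra_simps)
next
  fix x y b assume "x \<in> C" "y \<in> C" "b \<in> C"
  then show "act x (act y b) = act (act x y) (act x b)"
    by (cases x; cases y; cases b) (simp, rule pass_under_mv)
qed

text \<open>
  All tangles in question act on colours deterministically: the first two strands, with colours \<open>q\<close>
  and \<open>(w, c)\<close>, are not changed, and the other two obtain colours that depend on \<open>w\<close>.  The directions
  are preserved.
\<close>

definition acts_as :: "bool \<Rightarrow> bool \<Rightarrow> word \<Rightarrow> (int \<Rightarrow> int \<Rightarrow> int) \<Rightarrow> (int \<Rightarrow> int \<Rightarrow> int \<Rightarrow> int) \<Rightarrow> bool" where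
  "acts_as up c B f g \<longleftrightarrow> (\<forall>w \<in> R. \<forall>x \<in> R. f w x \<in> R \<and> (\<forall>y \<in> R. g w x y \<in> R \<and> 
     (\<forall>\<phi> q b r. q \<in> C \<longrightarrow> ev B \<phi> (q # (w, c) # (x, up) # (y, b) # r) = \<phi> (q # (w, c) # (f w x, up) # (g w x y, b) # r))))"

lemma acts_asD:
  assumes "acts_as up c B f g" "w \<in> R" "x \<in> R" "y \<in> R" "q \<in> C"
  shows "ev B \<phi> (q # (w, c) # (x, up) # (y, b) # r)
       = \<phi> (q # (w, c) # (f w x, up) # (g w x y, b) # r)"
  using assms unfolding acts_as_def by blast

lemma acts_as_core: "acts_as up c core (\<lambda>w x. x) (\<lambda>w x y. pass_under c w y)"
  by (simp add: acts_as_def core_def eval_nat_numeral)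

text \<open>
  The colour \<open>z\<close> at the minimum is determined by the maximum at the top: the returning
  strand has the colour \<open>f w x\<close> of the third strand above \<open>B\<close> and the opposite direction, so the fourth
  strand of \<open>B\<close> starts with that colour.
\<close>

lemma acts_as_gate:
  assumes "acts_as up c B f g"
  defines "f' \<equiv> \<lambda>w x. pass_under (\<not> up) (f w x) (pass_under (\<not> up) (f w x) (g w x (f w x)))"
  shows "acts_as up c (gate B) f' (\<lambda>w x y. pass_under up (f' w x) (pass_under (\<not> up) (g w x (f w x)) y))"
  unfolding acts_as_def
proof (intro ballI conjI allI impI)
  fix w x y q b r and \<phi> :: "(int \<times> bool) list \<Rightarrow> nat"
  assume R: "w \<in> R" "x \<in> R" "y \<in> R" "q \<in> C"
  let ?g = "pass_under up (f' w x) (pass_under (\<not> up) (g w x (f w x)) y)"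
  let ?res = "q # (w, c) # (f' w x, up) # (?g, b) # r"
  have fR: "f w x \<in> R" using assms(1) R by (auto simp: acts_as_def)
  let ?rest = "sweep @ clasp @ unsweep @ [virt 2, (Cap, 3)]"
  have 1: "ev (B @ ?rest) \<phi> (q # (w, c) # (x, up) # z # bar z # (y, b) # r)
      = (if z = (f w x, up) then \<phi> ?res else 0)" if "z \<in> C" for z
  proof -
    obtain z1 z2 where z: "z = (z1, z2)" by fastforce
    then have z1: "z1 \<in> R" using that by simp
    have "ev (B @ ?rest) \<phi> (q # (w, c) # (x, up) # z # bar z # (y, b) # r)
        = ev ?rest \<phi> (q # (w, c) # (f w x, up) # (g w x z1, z2) # (z1, \<not> z2) # (y, b) # r)"
      unfolding z ev_append acts_asD[OF assms(1) R(1,2) z1 R(4)] by simp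
    also have "\<dots> = (if z = (f w x, up) then \<phi> ?res else 0)"
      using R z1 pass_under_cancel[of "pass_under (\<not> up) (g w x (f w x)) y" up "f w x"]
      by (auto simp: z f'_def sweep_def clasp_def unsweep_def eval_nat_numeral)
    finally show ?thesis .
  qed
  have "ev (gate B) \<phi> (q # (w, c) # (x, up) # (y, b) # r)
      = (\<Sum>z \<in> C. ev (B @ ?rest) \<phi> (q # (w, c) # (x, up) # z # bar z # (y, b) # r))"
    unfolding gate_def by (simp add: eval_nat_numeral)
  also have "\<dots> = (\<Sum>z \<in> C. if z = (f w x, up) then \<phi> ?res else 0)"
    using 1 by (rule sum.cong[OF HOL.refl])
  also have "\<dots> = \<phi> ?res" using fR by (subst sum_C_delta) auto
  finally show "ev (gate B) \<phi> (q # (w, c) # (x, up) # (y, b) # r) = \<phi> ?res" .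
qed (simp_all add: f'_def)

lemma ev_join:
  assumes "acts_as up c B f g" "w \<in> R" "x \<in> R" "q \<in> C"
  shows "ev (join B) \<phi> (q # (w, c) # (x, up) # r) = \<phi> (q # (w, c) # (g w x (f w x), up) # r)"
proof -
  let ?res = "q # (w, c) # (g w x (f w x), up) # r"
  have fR: "f w x \<in> R" using assms by (auto simp: acts_as_def)
  let ?rest = "[virt 2, (Cap, 3)]"
  have 1: "ev (B @ ?rest) \<phi> (q # (w, c) # (x, up) # z # bar z # r)
      = (if z = (f w x, up) then \<phi> ?res else 0)" if "z \<in> C" for z
  proof -
    obtain z1 z2 where z: "z = (z1, z2)" by fastforce
    then have z1: "z1 \<in> R" using that by simp
    have "ev (B @ ?rest) \<phi> (q # (w, c) # (x, up) # z # bar z # r)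
        = ev ?rest \<phi> (q # (w, c) # (f w x, up) # (g w x z1, z2) # (z1, \<not> z2) # r)"
      unfolding z ev_append acts_asD[OF assms(1-3) z1 assms(4)] by simp
    also have "\<dots> = (if z = (f w x, up) then \<phi> ?res else 0)"
      using z1 by (auto simp: z eval_nat_numeral)
    finally show ?thesis .
  qed
  have "ev (join B) \<phi> (q # (w, c) # (x, up) # r)
      = (\<Sum>z \<in> C. ev (B @ ?rest) \<phi> (q # (w, c) # (x, up) # z # bar z # r))"
    unfolding join_def by (simp add: eval_nat_numeral)
  also have "\<dots> = (\<Sum>z \<in> C. if z = (f w x, up) then \<phi> ?res else 0)"
    using 1 by (rule sum.cong[OF HOL.refl])
  also have "\<dots> = \<phi> ?res" using fR by (subst sum_C_delta) auto
  finally show ?thesis .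
qed

text \<open>
  The colour \<open>w\<close> of the returning strand is free at the minimum.  The maximum at the top
  demands that \<open>w\<close> is the colour with which the third strand leaves \<open>X\<close>, and it fixes the directions.
\<close>

lemma ev_close_up:
  assumes X: "\<And>c w x q \<phi> r. w \<in> R \<Longrightarrow> x \<in> R \<Longrightarrow> q \<in> C \<Longrightarrow>
      ev X \<phi> (q # (w, c) # (x, up) # r) = \<phi> (q # (w, c) # (F c w x, up) # r)"
    and u: "u \<in> R"
  shows "ev (close_up X) \<phi> ((u, up) # r) =
    (\<Sum>w \<in> R. if F (\<not> up) w u = w then \<phi> ((pass_under (\<not> up) w (pass_under up u w), up) # r) else 0)"
proof -
  have 1: "ev ([virt 0, virt 1, over 1, over 0] @ X @ [(Cap, 1)]) \<phi> (z # bar z # (u, up) # r)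
      = (if snd z = up \<and> F (\<not> up) (fst z) u = fst z
         then \<phi> ((pass_under (\<not> up) (fst z) (pass_under up u (fst z)), up) # r) else 0)" if "z \<in> C" for z
  proof -
    obtain w b where z: "z = (w, b)" by fastforce
    then have w: "w \<in> R" using that by simp
    have "ev ([virt 0, virt 1, over 1, over 0] @ X @ [(Cap, 1)]) \<phi> (z # bar z # (u, up) # r)
        = ev [(Cap, 1)] \<phi> ((pass_under (\<not> b) w (pass_under up u w), b) # (w, \<not> b) # (F (\<not> b) w u, up) # r)"
      using w u X[of w u "(pass_under (\<not> b) w (pass_under up u w), b)"] by (simp add: z ev_append eval_nat_numeral)
    also have "\<dots> = (if b = up \<and> F (\<not> up) w u = w
         then \<phi> ((pass_under (\<not> up) w (pass_under up u w), up) # r) else 0)"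
      by (auto simp: eval_nat_numeral)
    finally show ?thesis using z by simp
  qed
  have "ev (close_up X) \<phi> ((u, up) # r)
      = (\<Sum>z \<in> C. ev ([virt 0, virt 1, over 1, over 0] @ X @ [(Cap, 1)]) \<phi> (z # bar z # (u, up) # r))"
    unfolding close_up_def by simp
  also have "\<dots> = (\<Sum>z \<in> C. if snd z = up \<and> F (\<not> up) (fst z) u = fst z
         then \<phi> ((pass_under (\<not> up) (fst z) (pass_under up u (fst z)), up) # r) else 0)"
    using 1 by (rule sum.cong[OF HOL.refl])
  also have "\<dots> = (\<Sum>w \<in> R. \<Sum>b \<in> UNIV. if b = up \<and> F (\<not> up) w u = w
         then \<phi> ((pass_under (\<not> up) w (pass_under up u w), up) # r) else 0)"
    by (simp add: sum.cartesian_product case_prod_unfold)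
  also have "\<dots> = (\<Sum>w \<in> R. if F (\<not> up) w u = w then \<phi> ((pass_under (\<not> up) w (pass_under up u w), up) # r) else 0)"
    by (rule sum.cong) (auto simp: UNIV_bool)
  finally show ?thesis .
qed

text \<open>
  Let \<open>f\<close> be the colour of the third strand above \<open>n\<close> gates and \<open>e\<close> the colour with which it then
  passes through the fourth strand.  One more gate replaces \<open>(f, e)\<close> by \<open>(f', e')\<close> with
  \<open>f' = 4 e - 3 f\<close> and \<open>2 e' = 3 f' - e\<close>, starting with \<open>(x, 2 x - w)\<close>.  Both are linear recurrences in
  the differences to \<open>x\<close>, and their solution is given after multiplication by \<open>2^n\<close>.
\<close>

lemma acts_as_gates_True:
  "\<exists>f g. acts_as True c (gates n core) f g \<and> (c = False \<longrightarrow> (\<forall>w \<in> R. \<forall>x \<in> R. \<exists>k l.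
     2 ^ n * (f w x - x) = 8 * (2 ^ n - 3 ^ n) * (w - x) + N * k \<and>
     2 ^ n * (g w x (f w x) - x) = (8 * 2 ^ n - 9 * 3 ^ n) * (w - x) + N * l))"
proof (induction n)
  case 0
  have "acts_as True c (gates 0 core) (\<lambda>w x. x) (\<lambda>w x y. pass_under c w y)"
    using acts_as_core by (simp add: gates_def)
  moreover have "\<exists>l. pass_under False w x - x = - (w - x) + N * l" for w x
    using pass_under_False[of w x] by auto
  ultimately show ?case by (intro exI conjI) auto
next
  case (Suc n)
  then obtain f g where fg: "acts_as True c (gates n core) f g"
    and E: "c = False \<Longrightarrow> w \<in> R \<Longrightarrow> x \<in> R \<Longrightarrow> \<exists>k l.
     2 ^ n * (f w x - x) = 8 * (2 ^ n - 3 ^ n) * (w - x) + N * k \<and>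
     2 ^ n * (g w x (f w x) - x) = (8 * 2 ^ n - 9 * 3 ^ n) * (w - x) + N * l" for w x
    by blast
  let ?f = "\<lambda>w x. pass_under False (f w x) (pass_under False (f w x) (g w x (f w x)))"
  let ?g = "\<lambda>w x y. pass_under True (?f w x) (pass_under False (g w x (f w x)) y)"
  have "acts_as True c (gates (Suc n) core) ?f ?g"
    using acts_as_gate[OF fg] by (simp add: gates_def)
  moreover have "\<exists>k l. 2 ^ Suc n * (?f w x - x) = 8 * (2 ^ Suc n - 3 ^ Suc n) * (w - x) + N * k \<and>
     2 ^ Suc n * (?g w x (?f w x) - x) = (8 * 2 ^ Suc n - 9 * 3 ^ Suc n) * (w - x) + N * l"
    if asm: "c = False" "w \<in> R" "x \<in> R" for w x
  proof -
    \<comment> \<open>\<open>a\<close> and \<open>e\<close> are the colours before the new gate, \<open>a'\<close> and \<open>e'\<close> the ones after it.\<close>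
    define a e a' b e' P Q d where "a = f w x" and "e = g w x a" and "a' = ?f w x"
      and "b = pass_under False e a'" and "e' = pass_under True a' b" and "P = (2 :: int) ^ n" and "Q = (3 :: int) ^ n"
      and "d = w - x"
    obtain k l where kl: "P * (a - x) = 8 * (P - Q) * d + N * k" "P * (e - x) = (8 * P - 9 * Q) * d + N * l"
      using E[OF asm] unfolding a_def e_def P_def Q_def d_def by blast
    obtain k1 where k1: "pass_under False a e = 2 * e - a + N * k1" using pass_under_False by blast
    obtain k2 where k2: "a' = 2 * pass_under False a e - a + N * k2"
      using pass_under_False unfolding a'_def e_def a_def by blast
    obtain k3 where k3: "b = 2 * a' - e + N * k3" using pass_under_False unfolding b_def by blast
    obtain k4 where k4: "2 * e' = b + a' + N * k4" using pass_under_True unfolding e'_def by blast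
    have a': "a' - x = 4 * (e - x) - 3 * (a - x) + N * (2 * k1 + k2)"
      using k1 k2 by (simp add: algebra_simps)
    have "2 * P * (a' - x) = 8 * (P * (e - x)) - 6 * (P * (a - x)) + N * (2 * P * (2 * k1 + k2))"
      unfolding a' by (simp add: algebra_simps)
    also have "\<dots> = 8 * (2 * P - 3 * Q) * d + N * (8 * l - 6 * k + 2 * P * (2 * k1 + k2))"
      unfolding kl by (simp add: algebra_simps)
    finally have A: "2 * P * (a' - x) = 8 * (2 * P - 3 * Q) * d + N * (8 * l - 6 * k + 2 * P * (2 * k1 + k2))" .
    have e': "2 * (e' - x) = 3 * (a' - x) - (e - x) + N * (k3 + k4)"
      using k3 k4 by (simp add: algebra_simps)
    have "2 * (2 * P * (e' - x)) = 2 * P * (2 * (e' - x))" by simp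
    also have "\<dots> = 3 * (2 * P * (a' - x)) - 2 * (P * (e - x)) + N * (2 * P * (k3 + k4))"
      unfolding e' by (simp add: algebra_simps)
    also have "\<dots> = 2 * ((16 * P - 27 * Q) * d) + N * (3 * (8 * l - 6 * k + 2 * P * (2 * k1 + k2)) - 2 * l + 2 * P * (k3 + k4))"
      unfolding kl A by (simp add: algebra_simps)
    finally have "2 * (2 * P * (e' - x) - (16 * P - 27 * Q) * d)
        = N * (3 * (8 * l - 6 * k + 2 * P * (2 * k1 + k2)) - 2 * l + 2 * P * (k3 + k4))"
      by (simp add: algebra_simps)
    then have "N dvd 2 * P * (e' - x) - (16 * P - 27 * Q) * d"
      by (metis dvd_double dvd_triv_left)
    then obtain m where "2 * P * (e' - x) - (16 * P - 27 * Q) * d = N * m" by blast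
    then have "2 * P * (e' - x) = (8 * (2 * P) - 9 * (3 * Q)) * d + N * m" by (simp add: algebra_simps)
    with A show ?thesis
      unfolding e'_def b_def a'_def e_def a_def d_def P_def Q_def power_Suc by blast
  qed
  ultimately show ?case by blast
qed

text \<open>
  In the opposite orientation the colour \<open>e\<close> with which the strand leaves is the same for every number
  of gates: the new value \<open>2 b - a'\<close> with \<open>2 b = a' + e\<close> is \<open>e\<close>.
\<close>

lemma acts_as_gates_False:
  "\<exists>f g. acts_as False c (gates n core) f g \<and> (c = True \<longrightarrow> (\<forall>w \<in> R. \<forall>x \<in> R. \<exists>k.
     2 * g w x (f w x) = x + w + N * k))"
proof (induction n)
  case 0
  have "acts_as False c (gates 0 core) (\<lambda>w x. x) (\<lambda>w x y. pass_under c w y)"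
    using acts_as_core by (simp add: gates_def)
  then show ?case using pass_under_True by (intro exI conjI) auto
next
  case (Suc n)
  then obtain f g where fg: "acts_as False c (gates n core) f g"
    and E: "c = True \<Longrightarrow> w \<in> R \<Longrightarrow> x \<in> R \<Longrightarrow> \<exists>k. 2 * g w x (f w x) = x + w + N * k" for w x
    by blast
  let ?f = "\<lambda>w x. pass_under True (f w x) (pass_under True (f w x) (g w x (f w x)))"
  let ?g = "\<lambda>w x y. pass_under False (?f w x) (pass_under True (g w x (f w x)) y)"
  have "acts_as False c (gates (Suc n) core) ?f ?g"
    using acts_as_gate[OF fg] by (simp add: gates_def)
  moreover have "\<exists>k. 2 * ?g w x (?f w x) = x + w + N * k" if asm: "c = True" "w \<in> R" "x \<in> R" for w x
  proof -
    define e a' b where "e = g w x (f w x)" and "a' = ?f w x" and "b = pass_under True e a'"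
    obtain k where k: "2 * e = x + w + N * k" using E[OF asm] unfolding e_def by blast
    obtain k1 where k1: "2 * b = a' + e + N * k1" using pass_under_True unfolding b_def by blast
    obtain k2 where k2: "pass_under False a' b = 2 * b - a' + N * k2" using pass_under_False by blast
    have "2 * pass_under False a' b = x + w + N * (k + 2 * k1 + 2 * k2)"
      using k k1 k2 by (simp add: algebra_simps)
    then show ?thesis
      unfolding a'_def b_def e_def by blast
  qed
  ultimately show ?case by blast
qed

definition multiplicity :: "nat \<Rightarrow> int \<Rightarrow> nat" where
  "multiplicity n u = card {w \<in> R. N dvd (9 * 3 ^ n - 7 * 2 ^ n) * (w - u)}"

text \<open>
  The condition \<open>e = w\<close> on the returning colour becomes linear after multiplication by \<open>2^n\<close>, which is
  invertible.  The outgoing colour is \<open>2 * ((w + u) / 2) - w = u\<close>.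
\<close>

lemma ev_long_chain_True:
  assumes u: "u \<in> R"
  shows "ev (long_chain n) \<phi> ((u, True) # r) = multiplicity n u * \<phi> ((u, True) # r)"
proof -
  have "\<forall>c. \<exists>f g. acts_as True c (gates n core) f g \<and> (c = False \<longrightarrow> (\<forall>w \<in> R. \<forall>x \<in> R. \<exists>k l.
     2 ^ n * (f w x - x) = 8 * (2 ^ n - 3 ^ n) * (w - x) + N * k \<and>
     2 ^ n * (g w x (f w x) - x) = (8 * 2 ^ n - 9 * 3 ^ n) * (w - x) + N * l))"
    using acts_as_gates_True by blast
  then obtain f g where fg: "\<And>c. acts_as True c (gates n core) (f c) (g c)"
    and E: "\<And>w x. w \<in> R \<Longrightarrow> x \<in> R \<Longrightarrow> \<exists>l. 2 ^ n * (g False w x (f False w x) - x) = (8 * 2 ^ n - 9 * 3 ^ n) * (w - x) + N * l"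
    by metis
  let ?F = "\<lambda>c w x. g c w x (f c w x)"
  have FR: "?F c w x \<in> R" if "w \<in> R" "x \<in> R" for c w x
    using fg that by (auto simp: acts_as_def)
  have "ev (long_chain n) \<phi> ((u, True) # r)
      = (\<Sum>w \<in> R. if ?F False w u = w then \<phi> ((pass_under False w (pass_under True u w), True) # r) else 0)"
    unfolding long_chain_def using ev_close_up[of "join (gates n core)" True ?F, OF ev_join[OF fg] u] by (simp cong: if_cong)
  also have "\<dots> = (\<Sum>w \<in> R. if N dvd (9 * 3 ^ n - 7 * 2 ^ n) * (w - u) then \<phi> ((u, True) # r) else 0)"
  proof (rule sum.cong[OF HOL.refl])
    fix w assume w: "w \<in> R"
    obtain l where l: "2 ^ n * (?F False w u - u) = (8 * 2 ^ n - 9 * 3 ^ n) * (w - u) + N * l"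
      using E[OF w u] by blast
    have eq: "2 ^ n * (?F False w u - w) = N * l - (9 * 3 ^ n - 7 * 2 ^ n) * (w - u)"
      using l by (simp add: algebra_simps)
    have "?F False w u = w \<longleftrightarrow> N dvd (9 * 3 ^ n - 7 * 2 ^ n) * (w - u)"
    proof
      assume "?F False w u = w"
      then have "(9 * 3 ^ n - 7 * 2 ^ n) * (w - u) = N * l" using eq by simp
      then show "N dvd (9 * 3 ^ n - 7 * 2 ^ n) * (w - u)" by simp
    next
      assume "N dvd (9 * 3 ^ n - 7 * 2 ^ n) * (w - u)"
      then have "N dvd 2 ^ n * (?F False w u - w)" unfolding eq by (rule dvd_diff[OF dvd_triv_left])
      then show "?F False w u = w" using R_eqI[OF FR[OF w u] w] dvd_power_2 by blast
    qed
    moreover have "pass_under False w (pass_under True u w) = u"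
    proof (rule R_eqI)
      obtain k where k: "pass_under False w (pass_under True u w) = 2 * pass_under True u w - w + N * k" using pass_under_False by blast
      obtain k' where k': "2 * pass_under True u w = w + u + N * k'" using pass_under_True by blast
      have "pass_under False w (pass_under True u w) - u = N * (k + k')" using k k' by (simp add: algebra_simps)
      then show "N dvd pass_under False w (pass_under True u w) - u" by simp
    qed (use u in auto)
    ultimately show "(if ?F False w u = w then \<phi> ((pass_under False w (pass_under True u w), True) # r) else 0)
        = (if N dvd (9 * 3 ^ n - 7 * 2 ^ n) * (w - u) then \<phi> ((u, True) # r) else 0)" by simp
  qed
  also have "\<dots> = multiplicity n u * \<phi> ((u, True) # r)"
    by (simp add: multiplicity_def R_def sum.If_cases Int_def)
  finally show ?thesis .
qed

text \<open>
  Here the condition is \<open>(u + w) / 2 = w\<close>, which has the only solution \<open>w = u\<close>.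
\<close>

lemma ev_long_chain_False:
  assumes u: "u \<in> R"
  shows "ev (long_chain n) \<phi> ((u, False) # r) = \<phi> ((u, False) # r)"
proof -
  obtain f g where fg: "\<And>c. acts_as False c (gates n core) (f c) (g c)"
    and E: "\<And>w x. w \<in> R \<Longrightarrow> x \<in> R \<Longrightarrow> \<exists>k. 2 * g True w x (f True w x) = x + w + N * k"
    using acts_as_gates_False[of _ n] by metis
  let ?F = "\<lambda>c w x. g c w x (f c w x)"
  have FR: "?F c w x \<in> R" if "w \<in> R" "x \<in> R" for c w x
    using fg that by (auto simp: acts_as_def)
  have "ev (long_chain n) \<phi> ((u, False) # r)
      = (\<Sum>w \<in> R. if ?F True w u = w then \<phi> ((pass_under True w (pass_under False u w), False) # r) else 0)"
    unfolding long_chain_def using ev_close_up[of "join (gates n core)" False ?F, OF ev_join[OF fg] u] by (simp cong: if_cong)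
  also have "\<dots> = (\<Sum>w \<in> R. if w = u then \<phi> ((u, False) # r) else 0)"
  proof (rule sum.cong[OF HOL.refl])
    fix w assume w: "w \<in> R"
    obtain k where k: "2 * ?F True w u = u + w + N * k" using E[OF w u] by blast
    have "?F True w u = w \<longleftrightarrow> w = u"
    proof
      assume "?F True w u = w"
      then have "w - u = N * k" using k by simp
      then have "N dvd w - u" by simp
      then show "w = u" by (rule R_eqI[OF w u])
    next
      assume "w = u"
      then have "2 * (?F True w u - w) = N * k" using k by simp
      then have "N dvd ?F True w u - w" by (metis dvd_double dvd_triv_left)
      then show "?F True w u = w" by (rule R_eqI[OF FR[OF w u] w])
    qed
    moreover have "pass_under True u (pass_under False u u) = u"
      using pass_under_cancel[OF u, of False u] by simp
    ultimately show "(if ?F True w u = w then \<phi> ((pass_under True w (pass_under False u w), False) # r) else 0)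
        = (if w = u then \<phi> ((u, False) # r) else 0)" by auto
  qed
  also have "\<dots> = \<phi> ((u, False) # r)" using u by (simp add: R_def)
  finally show ?thesis .
qed

end

section \<open>Inserting the long knots into a virtual knot\<close>

text \<open>
  The word of every diagram begins with a minimum; the long knot is inserted into its left leg.
\<close>

definition insert_chain :: "nat \<Rightarrow> word \<Rightarrow> word" where
  "insert_chain n w = [(Cup, 0)] @ long_chain n @ w"

lemma diagram_starts_with_Cup:
  assumes "is_diagram w"
  obtains w' where "w = (Cup, 0) # w'" "tangle 2 w' 0"
proof -
  have tan: "tangle 0 w 0" and "two.ev w (\<lambda>_. 1) [] = 2"
    using assms by (auto simp: is_diagram_iff)
  then have "w \<noteq> []" by auto
  then obtain p i w' where w: "w = (p, i) # w'" by (cases w) auto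
  then have "p = Cup" "i = 0" using tan by (cases p; simp)+
  then show thesis using that w tan by (simp add: numeral_2_eq_2)
qed

lemma isotopic_insert_chain_0:
  assumes "tangle 2 w 0"
  shows "isotopic 0 0 (insert_chain 0 w) ((Cup, 0) # w)"
proof -
  have "isotopic 2 2 (long_chain 0) []" using isotopic_add_strands[OF isotopic_long_chain_0, of 1] by (simp add: numeral_2_eq_2)
  then have "isotopic 0 0 ([(Cup, 0)] @ long_chain 0 @ w) ([(Cup, 0)] @ [] @ w)"
    by (rule isotopic.in_context[rotated]) (use assms in auto)
  then show ?thesis by (simp add: insert_chain_def)
qed

lemma flip_insert_chain:
  assumes "tangle 2 w 0" "j < n"
  shows "\<exists>w'. flip 0 0 (insert_chain n w) w' \<and> isotopic 0 0 w' (insert_chain j w)"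
proof -
  obtain x where x: "flip 1 1 (long_chain n) x" "isotopic 1 1 x (long_chain j)"
    using flip_long_chain[OF assms(2)] by blast
  have "flip 2 2 (long_chain n) x" using flip_add_strands[OF x(1), of 1] by (simp add: numeral_2_eq_2)
  then have "flip 0 0 (insert_chain n w) ([(Cup, 0)] @ x @ w)"
    unfolding insert_chain_def by (rule flip_in_context[rotated]) (use assms in auto)
  moreover have "isotopic 2 2 x (long_chain j)" using isotopic_add_strands[OF x(2), of 1] by (simp add: numeral_2_eq_2)
  then have "isotopic 0 0 ([(Cup, 0)] @ x @ w) (insert_chain j w)"
    unfolding insert_chain_def by (rule isotopic.in_context[rotated]) (use assms in auto)
  ultimately show ?thesis by blast
qed

lemma is_diagram_insert_chain:
  assumes "is_diagram ((Cup, 0) # w)"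
  shows "is_diagram (insert_chain n w)"
proof -
  have w: "tangle 2 w 0" using assms by (simp add: is_diagram_def numeral_2_eq_2)
  have 0: "is_diagram (insert_chain 0 w)"
    using isotopic_is_diagram[OF isotopic_insert_chain_0[OF w]] assms by simp
  show ?thesis
  proof (cases "n = 0")
    case False
    then obtain w' where "flip 0 0 (insert_chain n w) w'" "isotopic 0 0 w' (insert_chain 0 w)"
      using flip_insert_chain[OF w] by blast
    then show ?thesis using 0 isotopic_is_diagram is_diagram_flip by blast
  qed (use 0 in simp)
qed

lemma (in affine) ev_insert_chain:
  "ev (insert_chain n w) \<phi> [] =
    (\<Sum>u \<in> R. multiplicity n u * ev w \<phi> [(u, True), (u, False)] + ev w \<phi> [(u, False), (u, True)])"
proof -
  have "ev (insert_chain n w) \<phi> [] = (\<Sum>x \<in> C. ev (long_chain n) (ev w \<phi>) [x, bar x])"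
    by (simp add: insert_chain_def ev_append)
  also have "\<dots> = (\<Sum>u \<in> R. \<Sum>b \<in> UNIV. ev (long_chain n) (ev w \<phi>) [(u, b), (u, \<not> b)])"
    by (simp add: sum.cartesian_product) (auto intro!: sum.cong)
  also have "\<dots> = (\<Sum>u \<in> R. multiplicity n u * ev w \<phi> [(u, True), (u, False)] + ev w \<phi> [(u, False), (u, True)])"
  proof (rule sum.cong[OF HOL.refl])
    fix u assume u: "u \<in> R"
    have "(\<Sum>b \<in> UNIV. f b) = f True + f False" for f :: "bool \<Rightarrow> nat"
      by (simp add: UNIV_bool)
    then show "(\<Sum>b \<in> UNIV. ev (long_chain n) (ev w \<phi>) [(u, b), (u, \<not> b)])
        = multiplicity n u * ev w \<phi> [(u, True), (u, False)] + ev w \<phi> [(u, False), (u, True)]"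
      using u by (simp add: ev_long_chain_True ev_long_chain_False)
  qed
  finally show ?thesis .
qed

text \<open>
  An orientation becomes a colouring if all residues are zero.
\<close>

lemma (in affine) orientation_step:
  "t \<in> ori.step p i s \<Longrightarrow> map (Pair 0) t \<in> step p i (map (Pair 0) s)"
proof (induction p i s arbitrary: t rule: ori.step.induct)
  case (1 p s)
  have 0: "0 \<in> R" "pass_under b 0 0 = 0" for b using N by (auto simp: R_def pass_under_def)
  show ?case
  proof (cases "(p, s)" rule: ori.left_step.cases)
    case (3 k x y s')
    then show ?thesis using 1 0 by (cases k) (auto simp: ori.step.simps step.simps)
  qed (use 1 0 in \<open>auto simp: ori.step.simps step.simps image_iff split: if_splits\<close>)
qed (auto simp: ori.step.simps step.simps)

lemma (in affine) orientation_reach: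
  "ori.reach w s s' \<Longrightarrow> reach w (map (Pair 0) s) (map (Pair 0) s')"
proof (induction w arbitrary: s)
  case (Cons a w)
  obtain p i where a: "a = (p, i)" by fastforce
  with Cons obtain t where "t \<in> ori.step p i s" "ori.reach w t s'" by auto
  then show ?case using Cons.IH orientation_step a by (metis reach.simps(2))
qed simp

lemma coefficient_mono:
  "j < n \<Longrightarrow> 9 * 3 ^ j - 7 * 2 ^ j < (9 * 3 ^ n - 7 * 2 ^ n :: int)"
proof (rule lift_Suc_mono_less)
  fix n
  have "(2 :: int) ^ n \<le> 3 ^ n" by (rule power_mono) auto
  moreover have "(0 :: int) < 2 ^ n" by simp
  ultimately show "9 * 3 ^ n - 7 * 2 ^ n < (9 * 3 ^ Suc n - 7 * 2 ^ Suc n :: int)"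
    unfolding power_Suc by linarith
qed

text \<open>
  Both numbers of colourings are sums over the colour \<open>u\<close> at the place of insertion, with equal terms
  for one orientation of the curve.  In the other orientation the term for \<open>u\<close> is multiplied by the
  number of solutions \<open>w\<close>.  For \<open>n\<close> all residues are solutions, for \<open>j\<close> at least one is missing when
  \<open>u = 0\<close>, and this term is positive because the curve can be oriented.
\<close>

lemma knot_of_insert_chain_neq:
  assumes dia: "is_diagram ((Cup, 0) # w)" and "j < n"
  shows "knot_of (insert_chain j w) \<noteq> knot_of (insert_chain n w)"
proof
  assume same: "knot_of (insert_chain j w) = knot_of (insert_chain n w)"
  define N h :: int where "N = 9 * 3 ^ n - 7 * 2 ^ n" and "h = (N + 1) div 2"
  have jN: "9 * 3 ^ j - 7 * 2 ^ j < N" using coefficient_mono[OF assms(2)] by (simp add: N_def)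
  have j0: "0 < (9 * 3 ^ j - 7 * 2 ^ j :: int)"
  proof (cases "j = 0")
    case False
    then show ?thesis using coefficient_mono[of 0 j] by simp
  qed simp
  have "odd N" using assms(2) by (cases n) (auto simp: N_def)
  then have "2 * h - 1 = N" by (auto simp: h_def elim!: oddE)
  then interpret affine N h using jN j0 by unfold_locales auto
  have mult_n: "multiplicity n u = card R" for u
  proof -
    have "{w \<in> R. N dvd (9 * 3 ^ n - 7 * 2 ^ n) * (w - u)} = R" by (auto simp flip: N_def)
    then show ?thesis by (simp add: multiplicity_def)
  qed
  have le: "multiplicity j u \<le> card R" for u
    unfolding multiplicity_def by (rule card_mono) (auto simp: R_def)
  have less: "multiplicity j 0 < card R"
    unfolding multiplicity_def
  proof (rule psubset_card_mono)
    \<comment> \<open>The residue \<open>1\<close> is missing, since \<open>0 < 9 * 3^j - 7 * 2^j < N\<close>.\<close>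
    have "1 \<in> R" using N by (simp add: R_def)
    moreover have "\<not> N dvd (9 * 3 ^ j - 7 * 2 ^ j) * (1 - 0)"
      using zdvd_not_zless[OF j0 jN] by simp
    ultimately show "{w \<in> R. N dvd (9 * 3 ^ j - 7 * 2 ^ j) * (w - 0)} \<subset> R" by blast
  qed (simp add: R_def)
  have tan: "tangle 0 ((Cup, 0) # w) 0" using dia by (simp add: is_diagram_def)
  have "reach w [(0, True), (0, False)] []"
    using orientation_reach[OF closed_orientable[OF tan]] by simp
  then have pos: "0 < ev w (\<lambda>_. 1) [(0, True), (0, False)]" by (rule ev_pos) simp
  have "ev (insert_chain j w) (\<lambda>_. 1) [] < ev (insert_chain n w) (\<lambda>_. 1) []"
    unfolding ev_insert_chain mult_n
  proof (rule sum_strict_mono_ex1)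
    show "finite R" by (simp add: R_def)
    show "\<exists>u \<in> R. multiplicity j u * ev w (\<lambda>_. 1) [(u, True), (u, False)] + ev w (\<lambda>_. 1) [(u, False), (u, True)]
        < card R * ev w (\<lambda>_. 1) [(u, True), (u, False)] + ev w (\<lambda>_. 1) [(u, False), (u, True)]"
      using less pos N by (intro bexI[of _ 0]) (auto simp: R_def)
  qed (use le in auto)
  moreover have "ev (insert_chain j w) (\<lambda>_. 1) [] = ev (insert_chain n w) (\<lambda>_. 1) []"
    by (rule colourings_eq[OF symmetric_quandle_axioms _ _ same]) (rule is_diagram_insert_chain[OF dia])+
  ultimately show False by simp
qed

theorem corollary3p4:
  fixes L :: virtual_knot and n :: nat
  assumes "is_simplex 0 {L}"
    and "n \<ge> 1"
  shows "\<exists>S. is_simplex n S \<and> L \<in> S"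
proof -
  have "\<exists>D. L = abs_virtual_knot D"
    by (induction L rule: virtual_knot.abs_induct) blast
  then obtain D where D: "L = abs_virtual_knot D" by blast
  have dia: "is_diagram (Rep_diagram D)" using Rep_diagram[of D] by simp
  obtain w where w: "Rep_diagram D = (Cup, 0) # w" "tangle 2 w 0"
    using diagram_starts_with_Cup[OF dia] by blast
  note dia = dia[unfolded w(1)]
  define K where "K i = knot_of (insert_chain i w)" for i
  have K0: "K 0 = L"
    unfolding K_def using isotopic_knot_of[OF isotopic_insert_chain_0[OF w(2)] is_diagram_insert_chain[OF dia]]
    by (simp add: D knot_of_Rep flip: w(1))
  have neq: "K i \<noteq> K j" if "i \<noteq> j" for i j
    using knot_of_insert_chain_neq[OF dia] that unfolding K_def by (metis linorder_neqE_nat)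
  have steps: "shift_step (K i) (K j)" "shift_step (K j) (K i)" if less: "j < i" for i j
  proof -
    obtain w' where w': "flip 0 0 (insert_chain i w) w'" "isotopic 0 0 w' (insert_chain j w)"
      using flip_insert_chain[OF w(2) less] by blast
    have i: "is_diagram (insert_chain i w)" by (rule is_diagram_insert_chain[OF dia])
    then have "knot_of w' = K j"
      using isotopic_knot_of[OF w'(2)] is_diagram_flip[OF w'(1)] by (simp add: K_def)
    then show "shift_step (K i) (K j)" "shift_step (K j) (K i)"
      using shift_step_flip[OF w'(1) i] shift_step_unflip[OF w'(1) i] by (simp_all add: K_def)
  qed
  have dist: "d_A (K i) (K j) = 1" if "i \<noteq> j" for i j
    using that steps neq d_A_eq_1 by (metis linorder_neqE_nat)
  have "inj_on K {..n}" using neq by (auto simp: inj_on_def)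
  then have "card (K ` {..n}) = n + 1" by (simp add: card_image)
  moreover have "K ` {..n} \<in> gordian_complex"
    unfolding gordian_complex_def
  proof (intro CollectI conjI ballI impI)
    fix A B assume "A \<in> K ` {..n}" "B \<in> K ` {..n}" "A \<noteq> B"
    then obtain i j where "A = K i" "B = K j" "i \<noteq> j" by blast
    then show "d_A A B = 1" using dist by simp
  qed simp_all
  moreover have "L \<in> K ` {..n}" using K0 by (auto intro: image_eqI[of _ _ 0])
  ultimately show ?thesis unfolding is_simplex_def by blast
qed

end
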